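(* There exist a Følner sequence $\Phi$ in $\mathbb{N}$ and a set $A\subset\mathbb{N}$ that is $U^\infty(\Phi)$-uniform but is not an IP-set, i.e. there is no infinite set $B\subset\mathbb{N}$ with $\bigcup_{k\in\mathbb{N}}B^{\oplus k}\subset A$.
   Context: $\mathbb{N}=\{1,2,\dots\}$; $B^{\oplus \ell}=\{b_1+\cdots+b_\ell : b_i\in B,\ b_1<\cdots<b_\ell\}$. A Følner sequence $\Phi=(\Phi_N)$ is a sequence of finite (nonempty) subsets of $\mathbb{N}$ with $|\Phi_N\triangle(\Phi_N+t)|/|\Phi_N|\to0$ for every $t\in\mathbb{N}$; $\mathrm{d}_\Phi(A)=\lim_N|A\cap\Phi_N|/|\Phi_N|$ when it exists. A bounded $\phi:\mathbb{N}\to\mathbb{C}$ admits correlations along $\Phi$ if $\lim_N\frac{1}{|\Phi_N|}\sum_{n\in\Phi_N}\prod_{i=1}^m C^{\epsilon_i}\phi(n+h_i)$ exists for all $m$, $h_i\in\mathbb{N}$, $\epsilon_i\in\{0,1\}$ ($C$ = complex conjugation). For such $\phi$: $\|\phi\|_{U^0(\Phi)}=\lim_{N}\frac{1}{|\Phi_N|}\sum_{n\in\Phi_N}\phi(n)$ and $\|\phi\|_{U^{k+1}(\Phi)}^{2^{k+1}}=\lim_{H\to\infty}\frac1H\sum_{h=1}^H\|\Delta_h\phi\|_{U^k(\Phi)}^{2^k}$ with $(\Delta_h\phi)(n)=\phi(n)\overline{\phi(n+h)}$. A set $A\subset\mathbb{N}$ is $U^k(\Phi)$-uniform if $\mathbf{1}_A$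 admits correlations along $\Phi$, $\mathrm{d}_\Phi(A)>0$ and $\|\mathbf{1}_A-\mathrm{d}_\Phi(A)\|_{U^k(\Phi)}=0$; it is $U^\infty(\Phi)$-uniform if it is $U^k(\Phi)$-uniform for all $k\in\mathbb{N}$. *)

theory Defs
  imports "HOL-Analysis.Analysis"
begin

text \<open>
  Throughout, the natural numbers of the source start at 1. Sets of natural numbers are therefore
  subsets of \<open>{1..}\<close>, shifts are at least 1, and a function on the positive integers is a
  function of type \<open>nat \<Rightarrow> complex\<close> whose value at 0 is never used.
\<close>

definition folner_sequence :: "(nat \<Rightarrow> nat set) \<Rightarrow> bool" where
  "folner_sequence \<Phi> \<longleftrightarrow>
     (\<forall>N. finite (\<Phi> N) \<and> \<Phi> N \<noteq> {} \<and> \<Phi> N \<subseteq> {1..}) \<and>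
     (\<forall>t\<ge>1. (\<lambda>N. real (card (sym_diff (\<Phi> N) ((\<lambda>n. n + t) ` \<Phi> N))) / real (card (\<Phi> N)))
        \<longlonglongrightarrow> 0)"

definition relative_density :: "(nat \<Rightarrow> nat set) \<Rightarrow> nat set \<Rightarrow> nat \<Rightarrow> real" where
  "relative_density \<Phi> A N = real (card (A \<inter> \<Phi> N)) / real (card (\<Phi> N))"

definition folner_density :: "(nat \<Rightarrow> nat set) \<Rightarrow> nat set \<Rightarrow> real" where
  "folner_density \<Phi> A = lim (relative_density \<Phi> A)"

definition folner_average :: "(nat \<Rightarrow> nat set) \<Rightarrow> (nat \<Rightarrow> complex) \<Rightarrow> nat \<Rightarrow> complex" where
  "folner_average \<Phi> \<phi> N = (\<Sum>n\<in>\<Phi> N. \<phi> n) / of_nat (card (\<Phi> N))"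

definition admits_correlations :: "(nat \<Rightarrow> nat set) \<Rightarrow> (nat \<Rightarrow> complex) \<Rightarrow> bool" where
  "admits_correlations \<Phi> \<phi> \<longleftrightarrow>
     bounded (\<phi> ` {1..}) \<and>
     (\<forall>m\<ge>(1::nat). \<forall>h \<epsilon>. (\<forall>i\<in>{1..m}. h i \<ge> 1 \<and> \<epsilon> i \<in> {0, 1}) \<longrightarrow>
        convergent (folner_average \<Phi> (\<lambda>n. \<Prod>i=1..m. (cnj ^^ \<epsilon> i) (\<phi> (n + h i)))))"

definition mult_derivative :: "nat \<Rightarrow> (nat \<Rightarrow> complex) \<Rightarrow> nat \<Rightarrow> complex" where
  "mult_derivative h \<phi> n = \<phi> n * cnj (\<phi> (n + h))"

text \<open>
  The level-0 functional is complex valued, so all levels are. Level \<open>k + 1\<close> is the principal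
  \<open>2^(k + 1)\<close>-th root of its defining limit; for functions admitting correlations along a Folner
  sequence that limit exists and is a nonnegative real, and the root is the usual real one.
\<close>

fun uniformity_seminorm :: "(nat \<Rightarrow> nat set) \<Rightarrow> nat \<Rightarrow> (nat \<Rightarrow> complex) \<Rightarrow> complex" where
  "uniformity_seminorm \<Phi> 0 \<phi> = lim (folner_average \<Phi> \<phi>)"
| "uniformity_seminorm \<Phi> (Suc k) \<phi> =
     lim (\<lambda>H. (\<Sum>h=1..H. uniformity_seminorm \<Phi> k (mult_derivative h \<phi>) ^ (2 ^ k)) / of_nat H)
       powr (1 / 2 ^ Suc k)"

lemma uniformity_seminorm_Suc_power:
  "uniformity_seminorm \<Phi> (Suc k) \<phi> ^ (2 ^ Suc k) =
     lim (\<lambda>H. (\<Sum>h=1..H. uniformity_seminorm \<Phi> k (mult_derivative h \<phi>) ^ (2 ^ k)) / of_nat H)"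
proof -
  have "(z powr (1 / 2 ^ Suc k)) ^ (2 ^ Suc k) = z" for z :: complex
  proof (cases "z = 0")
    case False
    have "(z powr (1 / 2 ^ Suc k)) ^ (2 ^ Suc k) = exp (of_nat (2 ^ Suc k) * (1 / 2 ^ Suc k * Ln z))"
      using False by (simp only: powr_def if_False exp_of_nat_mult)
    also have "of_nat (2 ^ Suc k) * (1 / 2 ^ Suc k * Ln z) = Ln z"
      by simp
    finally show ?thesis
      using False by simp
  qed simp
  then show ?thesis
    by (simp only: uniformity_seminorm.simps)
qed

definition uniform_set :: "(nat \<Rightarrow> nat set) \<Rightarrow> nat \<Rightarrow> nat set \<Rightarrow> bool" where
  "uniform_set \<Phi> k A \<longleftrightarrow>
     A \<subseteq> {1..} \<and>
     admits_correlations \<Phi> (indicator A) \<and>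
     convergent (relative_density \<Phi> A) \<and>
     folner_density \<Phi> A > 0 \<and>
     uniformity_seminorm \<Phi> k (\<lambda>n. indicator A n - of_real (folner_density \<Phi> A)) = 0"

definition uniform_set_infinity :: "(nat \<Rightarrow> nat set) \<Rightarrow> nat set \<Rightarrow> bool" where
  "uniform_set_infinity \<Phi> A \<longleftrightarrow> (\<forall>k\<ge>1. uniform_set \<Phi> k A)"

definition distinct_sums :: "nat \<Rightarrow> nat set \<Rightarrow> nat set" where
  "distinct_sums l B =
     {\<Sum>i=1..l. b i | b. (\<forall>i\<in>{1..l}. b i \<in> B) \<and> strict_mono_on {1..l} b}"

definition IP_set :: "nat set \<Rightarrow> bool" where
  "IP_set A \<longleftrightarrow> (\<exists>B\<subseteq>{1..}. infinite B \<and> (\<Union>k\<in>{1..}. distinct_sums k B) \<subseteq> A)"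

end

theory Submission
  imports Defs
begin

text \<open>
  Let \<open>tm n\<close> be the Thue--Morse sign (\<open>-1\<close> to the binary digit sum of \<open>n\<close>); take \<open>A\<close> to be the
  set where \<open>tm\<close> is \<open>-1\<close>, averaged over \<open>{1..2^N}\<close>. Since \<open>tm (b + c) = tm b * tm c\<close> as soon as
  \<open>c\<close> is divisible by a power of 2 exceeding \<open>b\<close>, and finite sums from an infinite set contain such
  \<open>b\<close> and \<open>c\<close>, no set of finite sums fits into \<open>A\<close>.

  For uniformity, each derivative \<open>tm n * tm (n + h)\<close> is a limit of \<open>2^m\<close>-periodic functions, so its
  iterated averages converge and are close to Gowers averages modulo \<open>2^m\<close>. Splitting
  all variables of such an average into low and high binary digits expresses it through averages of
  the same kind with bounded shifts (the carries), and the two signs occurring among the low digits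
  produce cancellation, so the averages tend to 0.
\<close>

section \<open>Periodic sequences\<close>

lemma sum_periodic_window:
  fixes x :: "nat \<Rightarrow> real"
  assumes "\<And>n. x (n + Q) = x n"
  shows "(\<Sum>n=a..<a+Q. x n) = (\<Sum>n<Q. x n)"
proof (induction a)
  case 0
  then show ?case by (simp add: lessThan_atLeast0)
next
  case (Suc a)
  have "(\<Sum>n=Suc a..<Suc a+Q. x n) + x a = (\<Sum>n=a..<a+Q. x n) + x (a + Q)"
    by (cases "Q = 0") (simp_all add: sum.atLeast_Suc_lessThan)
  then show ?case using Suc assms by simp
qed

lemma sum_periodic_mult:
  fixes x :: "nat \<Rightarrow> real"
  assumes "\<And>n. x (n + Q) = x n"
  shows "(\<Sum>n=1..j*Q. x n) = j * (\<Sum>n<Q. x n)"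
proof (induction j)
  case (Suc j)
  have "{1..Suc j * Q} = {1..j*Q} \<union> {j*Q+1..<j*Q+1+Q}" by auto
  then have "(\<Sum>n=1..Suc j * Q. x n) = (\<Sum>n=1..j*Q. x n) + (\<Sum>n=j*Q+1..<j*Q+1+Q. x n)"
    by (simp only:) (rule sum.union_disjoint; auto)
  also have "(\<Sum>n=j*Q+1..<j*Q+1+Q. x n) = (\<Sum>n<Q. x n)"
    by (rule sum_periodic_window) (rule assms)
  finally show ?case using Suc by (simp add: algebra_simps)
qed simp

text \<open>The partial sums \<open>E\<close> of the sequence centred at its mean are again
  \<open>Q\<close>-periodic, hence bounded, so dividing by \<open>H\<close> sends them to 0.\<close>

lemma cesaro_periodic:
  fixes x :: "nat \<Rightarrow> real"
  assumes per: "\<And>n. x (n + Q) = x n" and "Q > 0"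
  shows "(\<lambda>H. (\<Sum>h=1..H. x h) / real H) \<longlonglongrightarrow> (\<Sum>h<Q. x h) / real Q"
proof -
  define \<mu> where "\<mu> = (\<Sum>h<Q. x h) / real Q"
  define E where "E H = (\<Sum>h=1..H. x h - \<mu>)" for H
  have E: "E (H + Q) = E H" for H
  proof -
    have "{1..H+Q} = {1..H} \<union> {H+1..<H+1+Q}" by auto
    then have "E (H + Q) = E H + (\<Sum>n=H+1..<H+1+Q. x n - \<mu>)"
      unfolding E_def by (simp only:) (rule sum.union_disjoint; auto)
    also have "(\<Sum>n=H+1..<H+1+Q. x n - \<mu>) = (\<Sum>n<Q. x n - \<mu>)"
      by (rule sum_periodic_window) (simp add: per)
    also have "\<dots> = 0" using \<open>Q > 0\<close> by (simp add: sum_subtractf \<mu>_def)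
    finally show ?thesis by simp
  qed
  have Emod: "E (i + j * Q) = E i" for i j
  proof (induction j)
    case (Suc j)
    have "i + Suc j * Q = i + j * Q + Q" by simp
    then show ?case using E[of "i + j * Q"] Suc by presburger
  qed simp
  have "\<bar>E H\<bar> \<le> (\<Sum>i<Q. \<bar>E i\<bar>)" for H
  proof -
    have "E H = E (H mod Q)" using Emod[of "H mod Q" "H div Q"] by simp
    then show ?thesis
      using member_le_sum[of "H mod Q" "{..<Q}" "\<lambda>i. \<bar>E i\<bar>"] \<open>Q > 0\<close> by simp
  qed
  then have "Bseq E" by (intro BseqI'[of _ "\<Sum>i<Q. \<bar>E i\<bar>"]) simp
  then have "(\<lambda>H. inverse (real H) * E H) \<longlonglongrightarrow> 0"
    by (intro lim_null_mult_right_bounded[where B="\<Sum>i<Q. \<bar>E i\<bar>"])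
       (auto simp: lim_inverse_n \<open>\<And>H. \<bar>E H\<bar> \<le> _\<close>)
  then have "(\<lambda>H. \<mu> + inverse (real H) * E H) \<longlonglongrightarrow> \<mu> + 0"
    by (intro tendsto_add tendsto_const)
  moreover have "\<mu> + inverse (real H) * E H = (\<Sum>h=1..H. x h) / real H" if "H > 0" for H
  proof -
    have "E H = (\<Sum>h=1..H. x h) - real H * \<mu>" by (simp add: E_def sum_subtractf)
    then show ?thesis using that by (simp add: field_simps)
  qed
  then have "\<forall>\<^sub>F H in sequentially. \<mu> + inverse (real H) * E H = (\<Sum>h=1..H. x h) / real H"
    using eventually_gt_at_top[of 0] by (rule eventually_mono[rotated])
  ultimately show ?thesis
    unfolding \<mu>_def[symmetric] by (simp add: filterlim_cong)
qed

text \<open>A Cauchy argument: the constant may change with \<open>e\<close>, so no limit has to be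
  guessed when approximating by periodic functions.\<close>

lemma convergent_if_near_constants:
  fixes x :: "nat \<Rightarrow> real"
  assumes "\<And>e. e > 0 \<Longrightarrow> \<exists>c. \<forall>\<^sub>F n in sequentially. \<bar>x n - c\<bar> \<le> e"
  shows "convergent x"
proof -
  have "Cauchy x"
  proof (rule CauchyI)
    fix e :: real assume "e > 0"
    then obtain c where "\<forall>\<^sub>F n in sequentially. \<bar>x n - c\<bar> \<le> e/3"
      using assms[of "e/3"] by auto
    then obtain M where M: "\<And>n. n \<ge> M \<Longrightarrow> \<bar>x n - c\<bar> \<le> e/3"
      by (auto simp: eventually_sequentially)
    show "\<exists>M. \<forall>m\<ge>M. \<forall>n\<ge>M. norm (x m - x n) < e"
    proof (intro exI allI impI)
      fix m n assume "M \<le> m" "M \<le> n"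
      then show "norm (x m - x n) < e"
        using M[of m] M[of n] \<open>e > 0\<close> by (simp add: abs_if split: if_splits)
    qed
  qed
  then show ?thesis by (rule Cauchy_convergent)
qed

section \<open>Uniformity averages of limit-periodic functions\<close>

definition bavg :: "(nat \<Rightarrow> real) \<Rightarrow> nat \<Rightarrow> real" where
  "bavg g N = (\<Sum>n=1..2^N. g n) / 2^N"

definition rderiv :: "nat \<Rightarrow> (nat \<Rightarrow> real) \<Rightarrow> nat \<Rightarrow> real" where
  "rderiv h g n = g n * g (n + h)"

text \<open>\<open>L\<close> plays the role of the \<open>2^k\<close>-th power of the seminorm along
  dyadic windows. As a predicate it also asserts that every inner limit exists, which a value given
  by \<open>lim\<close> would not.\<close>

fun has_unif :: "nat \<Rightarrow> (nat \<Rightarrow> real) \<Rightarrow> real \<Rightarrow> bool" where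
  "has_unif 0 g L \<longleftrightarrow> bavg g \<longlonglongrightarrow> L"
| "has_unif (Suc k) g L \<longleftrightarrow>
     (\<exists>l. (\<forall>h\<ge>1. has_unif k (rderiv h g) (l h)) \<and> (\<lambda>H. (\<Sum>h=1..H. l h) / real H) \<longlonglongrightarrow> L)"

text \<open>This bounds the upper limit of the dyadic L1 distance by \<epsilon>.\<close>

definition near :: "real \<Rightarrow> (nat \<Rightarrow> real) \<Rightarrow> (nat \<Rightarrow> real) \<Rightarrow> bool" where
  "near \<epsilon> g p \<longleftrightarrow> (\<forall>\<delta>>0. \<forall>\<^sub>F N in sequentially. bavg (\<lambda>n. \<bar>g n - p n\<bar>) N \<le> \<epsilon> + \<delta>)"

definition bdd1 :: "(nat \<Rightarrow> real) \<Rightarrow> bool" where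
  "bdd1 g \<longleftrightarrow> (\<forall>n. \<bar>g n\<bar> \<le> 1)"

text \<open>Almost periodicity in the Besicovitch sense, restricted to periods that are powers of
  2.\<close>

definition limit_periodic :: "(nat \<Rightarrow> real) \<Rightarrow> bool" where
  "limit_periodic g \<longleftrightarrow> bdd1 g \<and>
     (\<forall>\<epsilon>>0. \<exists>m p. bdd1 p \<and> (\<forall>n. p (n + 2^m) = p n) \<and> near \<epsilon> g p)"

lemma bdd1_rderiv: "bdd1 g \<Longrightarrow> bdd1 (rderiv h g)"
  by (auto simp: bdd1_def rderiv_def abs_mult intro!: mult_le_one)

lemma bavg_mono: "(\<And>n. f n \<le> g n) \<Longrightarrow> bavg f N \<le> bavg g N"
  by (auto simp: bavg_def intro!: divide_right_mono sum_mono)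

lemma bavg_add: "bavg (\<lambda>n. f n + g n) N = bavg f N + bavg g N"
  by (simp add: bavg_def sum.distrib add_divide_distrib)

lemma bavg_diff_le: "\<bar>bavg f N - bavg g N\<bar> \<le> bavg (\<lambda>n. \<bar>f n - g n\<bar>) N"
  by (simp add: bavg_def diff_divide_distrib[symmetric] sum_subtractf[symmetric] abs_divide
      divide_right_mono sum_abs)

lemma bavg_shift_le:
  assumes "\<And>n. 0 \<le> u n" "\<And>n. u n \<le> c"
  shows "bavg (\<lambda>n. u (n + h)) N \<le> bavg u N + c * h / 2^N"
proof -
  have "(\<Sum>n=1..2^N. u (n + h)) = (\<Sum>n=1+h..2^N+h. u n)"
    by (rule sum.shift_bounds_cl_nat_ivl[symmetric])
  also have "\<dots> \<le> (\<Sum>n\<in>{1..2^N} \<union> {2^N<..2^N+h}. u n)"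
    using assms by (intro sum_mono2) auto
  also have "\<dots> = (\<Sum>n=1..2^N. u n) + (\<Sum>n\<in>{2^N<..2^N+h}. u n)"
    by (intro sum.union_disjoint) auto
  also have "(\<Sum>n\<in>{2^N<..2^N+h}. u n) \<le> c * h"
    using sum_mono[of "{2^N<..2^N+h}" u "\<lambda>_. c"] assms by (simp add: mult.commute)
  finally show ?thesis
    by (simp add: bavg_def add_divide_distrib[symmetric] divide_right_mono)
qed

text \<open>The difference of products telescopes, and shifting the window by \<open>h\<close> costs
  only a term that vanishes as \<open>N\<close> grows. The factor 2 does not depend on
  \<open>h\<close>, which later permits averaging over \<open>h\<close>.\<close>

lemma near_rderiv:
  assumes "near \<epsilon> g p" "bdd1 g" "bdd1 p"
  shows "near (2 * \<epsilon>) (rderiv h g) (rderiv h p)"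
  unfolding near_def
proof (intro allI impI)
  fix \<delta> :: real assume "\<delta> > 0"
  define u where "u n = \<bar>g n - p n\<bar>" for n
  have u: "0 \<le> u n" "u n \<le> 2" for n
  proof -
    have "\<bar>g n\<bar> \<le> 1" "\<bar>p n\<bar> \<le> 1" using assms by (auto simp: bdd1_def)
    then show "0 \<le> u n" "u n \<le> 2" by (auto simp: u_def)
  qed
  have "(\<lambda>N. real (2 * h) * inverse (2::real) ^ N) \<longlonglongrightarrow> real (2*h) * 0"
    by (intro tendsto_mult tendsto_const LIMSEQ_power_zero) simp
  then have ev: "\<forall>\<^sub>F N in sequentially. (2 * h) * inverse (2::real) ^ N < \<delta>/3"
    using \<open>\<delta> > 0\<close> by (intro order_tendstoD(2)[of _ "0::real"]) auto
  have "\<forall>\<^sub>F N in sequentially. bavg u N \<le> \<epsilon> + \<delta>/3"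
    using assms(1) \<open>\<delta> > 0\<close> unfolding near_def u_def by (metis divide_pos_pos zero_less_numeral)
  with ev show "\<forall>\<^sub>F N in sequentially. bavg (\<lambda>n. \<bar>rderiv h g n - rderiv h p n\<bar>) N \<le> 2 * \<epsilon> + \<delta>"
  proof eventually_elim
    case (elim N)
    have "bavg (\<lambda>n. \<bar>rderiv h g n - rderiv h p n\<bar>) N \<le> bavg (\<lambda>n. u n + u (n + h)) N"
    proof (rule bavg_mono)
      fix n
      have "rderiv h g n - rderiv h p n = (g n - p n) * g (n+h) + p n * (g (n+h) - p (n+h))"
        by (simp add: rderiv_def algebra_simps)
      also have "\<bar>\<dots>\<bar> \<le> u n * \<bar>g (n+h)\<bar> + \<bar>p n\<bar> * u (n+h)"
        by (simp add: u_def abs_mult[symmetric])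
      also have "\<dots> \<le> u n * 1 + 1 * u (n+h)"
        using assms u by (intro add_mono mult_mono) (auto simp: bdd1_def)
      finally show "\<bar>rderiv h g n - rderiv h p n\<bar> \<le> u n + u (n+h)" by simp
    qed
    also have "\<dots> \<le> bavg u N + (bavg u N + 2 * h / 2^N)"
      using bavg_shift_le[of u 2 h N] u by (simp add: bavg_add)
    finally have "bavg (\<lambda>n. \<bar>rderiv h g n - rderiv h p n\<bar>) N \<le> bavg u N + (bavg u N + 2 * h / 2^N)" .
    moreover have "2 * h / 2^N < \<delta>/3"
      using elim(1) by (simp add: field_simps)
    ultimately show ?case using elim(2) by linarith
  qed
qed

text \<open>Each derivative at most doubles the L1 distance, uniformly in \<open>h\<close>, and
  averaging over \<open>h\<close> preserves the resulting bound.\<close>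

lemma has_unif_lipschitz:
  assumes "has_unif k g L" "has_unif k p L'" "bdd1 g" "bdd1 p" "near \<epsilon> g p"
  shows "\<bar>L - L'\<bar> \<le> 2^k * \<epsilon>"
  using assms
proof (induction k arbitrary: g p L L' \<epsilon>)
  case 0
  have lim: "(\<lambda>N. \<bar>bavg g N - bavg p N\<bar>) \<longlonglongrightarrow> \<bar>L - L'\<bar>"
    using 0 by (intro tendsto_rabs tendsto_diff) auto
  show ?case
  proof (rule field_le_epsilon)
    fix \<delta> :: real assume "\<delta> > 0"
    then have "\<forall>\<^sub>F N in sequentially. bavg (\<lambda>n. \<bar>g n - p n\<bar>) N \<le> \<epsilon> + \<delta>"
      using 0 by (simp add: near_def)
    then have "\<forall>\<^sub>F N in sequentially. \<bar>bavg g N - bavg p N\<bar> \<le> \<epsilon> + \<delta>"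
      by (rule eventually_mono) (use bavg_diff_le[of g _ p] order_trans in blast)
    then show "\<bar>L - L'\<bar> \<le> 2^0 * \<epsilon> + \<delta>"
      using tendsto_upperbound[OF lim] by simp
  qed
next
  case (Suc k)
  obtain l where l: "\<And>h. h \<ge> 1 \<Longrightarrow> has_unif k (rderiv h g) (l h)"
    and L: "(\<lambda>H. (\<Sum>h=1..H. l h) / real H) \<longlonglongrightarrow> L"
    using Suc.prems(1) by auto
  obtain l' where l': "\<And>h. h \<ge> 1 \<Longrightarrow> has_unif k (rderiv h p) (l' h)"
    and L': "(\<lambda>H. (\<Sum>h=1..H. l' h) / real H) \<longlonglongrightarrow> L'"
    using Suc.prems(2) by auto
  have d: "\<bar>l h - l' h\<bar> \<le> 2^k * (2 * \<epsilon>)" if "h \<ge> 1" for h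
    using that by (intro Suc.IH[OF l l'] bdd1_rderiv near_rderiv Suc.prems)
  have "(\<lambda>H. \<bar>(\<Sum>h=1..H. l h) / real H - (\<Sum>h=1..H. l' h) / real H\<bar>) \<longlonglongrightarrow> \<bar>L - L'\<bar>"
    by (intro tendsto_rabs tendsto_diff L L')
  moreover have "\<forall>\<^sub>F H in sequentially.
    \<bar>(\<Sum>h=1..H. l h) / real H - (\<Sum>h=1..H. l' h) / real H\<bar> \<le> 2 ^ Suc k * \<epsilon>"
    using eventually_gt_at_top[of 0]
  proof eventually_elim
    case (elim H)
    have "\<bar>(\<Sum>h=1..H. l h) - (\<Sum>h=1..H. l' h)\<bar> \<le> (\<Sum>h=1..H. \<bar>l h - l' h\<bar>)"
      by (simp add: sum_subtractf[symmetric] sum_abs)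
    also have "\<dots> \<le> (\<Sum>h=1..H. 2^k * (2 * \<epsilon>))" by (intro sum_mono d) simp
    finally show ?case using elim
      by (simp add: diff_divide_distrib[symmetric] abs_divide field_simps)
  qed
  ultimately show ?case by (intro tendsto_upperbound) auto
qed

section \<open>Existence of the iterated limits by periodic approximation\<close>

lemma rderiv_periodic:
  assumes "\<And>n. p (n + Q) = p n"
  shows "rderiv h p (n + Q) = rderiv h p n"
proof -
  have "n + Q + h = n + h + Q" by simp
  then show ?thesis unfolding rderiv_def using assms by presburger
qed

text \<open>For \<open>Q\<close>-periodic \<open>p\<close> and \<open>k \<ge> 1\<close> this is the
  \<open>2^k\<close>-th power of the Gowers norm on the integers modulo \<open>Q\<close>.\<close>

primrec cyc :: "nat \<Rightarrow> nat \<Rightarrow> (nat \<Rightarrow> real) \<Rightarrow> real" where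
  "cyc 0 Q p = (\<Sum>n<Q. p n) / real Q"
| "cyc (Suc k) Q p = (\<Sum>h<Q. cyc k Q (rderiv h p)) / real Q"

text \<open>For \<open>N \<ge> m\<close> the window \<open>{1..2^N}\<close> is a whole number of
  periods, so the averages over \<open>n\<close> are exact. The derivative is periodic in
  \<open>h\<close> too, so \<open>cesaro_periodic\<close> handles the outer averages.\<close>

lemma has_unif_periodic:
  assumes "\<And>n. p (n + 2^m) = p n"
  shows "has_unif k p (cyc k (2^m) p)"
  using assms
proof (induction k arbitrary: p)
  case 0
  have "bavg p N = cyc 0 (2^m) p" if "N \<ge> m" for N
  proof -
    have e: "(2::nat)^N = 2^(N-m) * 2^m" using that by (simp add: power_add[symmetric])
    have "(\<Sum>n=1..2^N. p n) = 2^(N-m) * (\<Sum>n<2^m. p n)"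
      unfolding e using sum_periodic_mult[of p "2^m" "2^(N-m)", OF 0] by simp
    moreover have "(2::real)^N = 2^(N-m) * 2^m" using that by (simp add: power_add[symmetric])
    ultimately show ?thesis by (simp add: bavg_def)
  qed
  then have "\<forall>\<^sub>F N in sequentially. bavg p N = cyc 0 (2^m) p"
    by (auto simp: eventually_sequentially)
  then show ?case by (auto intro: tendsto_eventually)
next
  case (Suc k)
  have "rderiv (h + 2^m) p = rderiv h p" for h
    using Suc.prems unfolding rderiv_def fun_eq_iff by (metis add.assoc)
  then have "(\<lambda>H. (\<Sum>h=1..H. cyc k (2^m) (rderiv h p)) / real H)
      \<longlonglongrightarrow> (\<Sum>h<2^m. cyc k (2^m) (rderiv h p)) / real (2^m)"
    by (intro cesaro_periodic) auto
  moreover have "has_unif k (rderiv h p) (cyc k (2^m) (rderiv h p))" for h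
    by (intro Suc.IH rderiv_periodic Suc.prems)
  ultimately show ?case by (auto intro!: exI[of _ "\<lambda>h. cyc k (2^m) (rderiv h p)"])
qed

lemma limit_periodic_rderiv:
  assumes "limit_periodic g"
  shows "limit_periodic (rderiv h g)"
  unfolding limit_periodic_def
proof (intro conjI allI impI)
  show "bdd1 (rderiv h g)" using assms by (simp add: limit_periodic_def bdd1_rderiv)
  fix \<epsilon> :: real assume "\<epsilon> > 0"
  then have "\<epsilon>/2 > 0" by simp
  then obtain m p where p: "bdd1 p" "\<forall>n. p (n + 2^m) = p n" "near (\<epsilon>/2) g p"
    using assms unfolding limit_periodic_def by blast
  have "rderiv h p (n + 2^m) = rderiv h p n" for n
    using p(2) by (intro rderiv_periodic) auto
  moreover have "near (2 * (\<epsilon>/2)) (rderiv h g) (rderiv h p)"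
    using p assms by (intro near_rderiv) (auto simp: limit_periodic_def)
  ultimately show "\<exists>m p. bdd1 p \<and> (\<forall>n. p (n + 2^m) = p n) \<and> near \<epsilon> (rderiv h g) p"
    using p by (intro exI[of _ m] exI[of _ "rderiv h p"]) (auto simp: bdd1_rderiv)
qed

text \<open>The averages for \<open>g\<close> eventually stay within \<open>e\<close> of the limit
  belonging to a periodic approximant. For the averages over \<open>h\<close> this rests on the
  Lipschitz bound being uniform in \<open>h\<close>.\<close>

lemma limit_periodic_has_unif:
  assumes "limit_periodic g"
  shows "\<exists>L. has_unif k g L"
  using assms
proof (induction k arbitrary: g)
  case 0
  have "convergent (bavg g)"
  proof (rule convergent_if_near_constants)
    fix e :: real assume "e > 0"
    then have e: "e/3 > 0" by simp
    then obtain m p where p: "bdd1 p" "\<forall>n. p (n + 2^m) = p n" "near (e/3) g p"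
      using 0 unfolding limit_periodic_def by blast
    have lim: "bavg p \<longlonglongrightarrow> cyc 0 (2^m) p" using has_unif_periodic[of p m 0] p by simp
    have "\<forall>\<^sub>F N in sequentially. dist (bavg p N) (cyc 0 (2^m) p) < e/3"
      using lim e by (rule tendstoD)
    moreover have "\<forall>\<^sub>F N in sequentially. bavg (\<lambda>n. \<bar>g n - p n\<bar>) N \<le> e/3 + e/3"
      using p(3) e unfolding near_def by blast
    ultimately have "\<forall>\<^sub>F N in sequentially. \<bar>bavg g N - cyc 0 (2^m) p\<bar> \<le> e"
    proof eventually_elim
      case (elim N)
      then show ?case using bavg_diff_le[of g N p] unfolding dist_real_def by linarith
    qed
    then show "\<exists>c. \<forall>\<^sub>F N in sequentially. \<bar>bavg g N - c\<bar> \<le> e" by blast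
  qed
  then show ?case by (simp add: convergent_def)
next
  case (Suc k)
  have "\<exists>L. has_unif k (rderiv h g) L" for h
    using Suc by (simp add: limit_periodic_rderiv)
  then obtain l where l: "\<And>h. has_unif k (rderiv h g) (l h)" by metis
  have "convergent (\<lambda>H. (\<Sum>h=1..H. l h) / real H)"
  proof (rule convergent_if_near_constants)
    fix e :: real assume "e > 0"
    \<comment> \<open>The Lipschitz bound for the derivatives is
      \<open>2^k * (2 * \<epsilon>)\<close>, which this choice makes \<open>e/2\<close>.\<close>
    define \<epsilon> where "\<epsilon> = e / 2 / 2 ^ Suc k"
    have e: "\<epsilon> > 0" using \<open>e > 0\<close> by (simp add: \<epsilon>_def)
    then obtain m p where p: "bdd1 p" "\<forall>n. p (n + 2^m) = p n" "near \<epsilon> g p"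
      using Suc.prems unfolding limit_periodic_def by blast
    obtain l' where l': "\<And>h. h \<ge> 1 \<Longrightarrow> has_unif k (rderiv h p) (l' h)"
      and L': "(\<lambda>H. (\<Sum>h=1..H. l' h) / real H) \<longlonglongrightarrow> cyc (Suc k) (2^m) p"
      using has_unif_periodic[of p m "Suc k"] p(2) by auto
    have d: "\<bar>l h - l' h\<bar> \<le> e/2" if "h \<ge> 1" for h
    proof -
      have "\<bar>l h - l' h\<bar> \<le> 2^k * (2 * \<epsilon>)" using that Suc.prems p
        by (intro has_unif_lipschitz[OF l l'] bdd1_rderiv near_rderiv) (auto simp: limit_periodic_def)
      then show ?thesis by (simp add: \<epsilon>_def)
    qed
    have "\<forall>\<^sub>F H in sequentially. dist ((\<Sum>h=1..H. l' h) / real H) (cyc (Suc k) (2^m) p) < e/2"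
      using \<open>e > 0\<close> by (intro tendstoD[OF L']) simp
    then have "\<forall>\<^sub>F H in sequentially. \<bar>(\<Sum>h=1..H. l h) / real H - cyc (Suc k) (2^m) p\<bar> \<le> e"
      using eventually_gt_at_top[of 0]
    proof eventually_elim
      case (elim H)
      have "\<bar>(\<Sum>h=1..H. l h) - (\<Sum>h=1..H. l' h)\<bar> \<le> (\<Sum>h=1..H. \<bar>l h - l' h\<bar>)"
        by (simp add: sum_subtractf[symmetric] sum_abs)
      also have "\<dots> \<le> (\<Sum>h=1..H. e/2)" by (intro sum_mono d) simp
      finally have "\<bar>(\<Sum>h=1..H. l h) / real H - (\<Sum>h=1..H. l' h) / real H\<bar> \<le> e/2" using elim
        by (simp add: diff_divide_distrib[symmetric] abs_divide field_simps)
      then show ?case using elim unfolding dist_real_def by linarith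
    qed
    then show "\<exists>c. \<forall>\<^sub>F H in sequentially. \<bar>(\<Sum>h=1..H. l h) / real H - c\<bar> \<le> e" by blast
  qed
  then show ?case using l by (auto simp: convergent_def)
qed

lemma has_unif_scale:
  "has_unif k g L \<Longrightarrow> has_unif k (\<lambda>n. c * g n) (c^(2^k) * L)"
proof (induction k arbitrary: g L c)
  case 0
  have "bavg (\<lambda>n. c * g n) = (\<lambda>N. c * bavg g N)"
    by (simp add: bavg_def fun_eq_iff sum_distrib_left)
  then show ?case using 0 by (auto intro: tendsto_mult_left)
next
  case (Suc k)
  obtain l where l: "\<And>h. h \<ge> 1 \<Longrightarrow> has_unif k (rderiv h g) (l h)"
    and L: "(\<lambda>H. (\<Sum>h=1..H. l h) / real H) \<longlonglongrightarrow> L"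
    using Suc.prems(1) by auto
  have "rderiv h (\<lambda>n. c * g n) = (\<lambda>n. c^2 * rderiv h g n)" for h
    by (simp add: rderiv_def fun_eq_iff power2_eq_square)
  then have "has_unif k (rderiv h (\<lambda>n. c * g n)) (c^(2^Suc k) * l h)" if "h \<ge> 1" for h
    using Suc.IH[OF l[OF that], of "c^2"] by (simp add: power_mult[symmetric])
  moreover have "(\<lambda>H. c^(2^Suc k) * ((\<Sum>h=1..H. l h) / real H)) \<longlonglongrightarrow> c^(2^Suc k) * L"
    by (intro tendsto_mult_left L)
  ultimately show ?case
    by (auto intro!: exI[of _ "\<lambda>h. c^(2^Suc k) * l h"] simp: sum_distrib_left)
qed

text \<open>Working with \<open>2^k\<close>-th powers removes the complex roots from the recursion,
  and on real functions the conjugation in the derivative is trivial.\<close>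

lemma uniformity_seminorm_eq:
  assumes "has_unif k g L"
  shows "uniformity_seminorm (\<lambda>N. {1..2^N}) k (\<lambda>n. complex_of_real (g n)) ^ (2^k) = of_real L"
  using assms
proof (induction k arbitrary: g L)
  case 0
  have "folner_average (\<lambda>N. {1..2^N}) (\<lambda>n. complex_of_real (g n)) = (\<lambda>N. of_real (bavg g N))"
    by (simp add: folner_average_def bavg_def fun_eq_iff)
  moreover have "(\<lambda>N. complex_of_real (bavg g N)) \<longlonglongrightarrow> of_real L"
    using 0 by (intro tendsto_of_real) simp
  ultimately show ?case by (simp add: limI)
next
  case (Suc k)
  obtain l where l: "\<And>h. h \<ge> 1 \<Longrightarrow> has_unif k (rderiv h g) (l h)"
    and L: "(\<lambda>H. (\<Sum>h=1..H. l h) / real H) \<longlonglongrightarrow> L"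
    using Suc.prems(1) by auto
  have "mult_derivative h (\<lambda>n. complex_of_real (g n)) = (\<lambda>n. of_real (rderiv h g n))" for h
    by (simp add: mult_derivative_def rderiv_def fun_eq_iff)
  then have "uniformity_seminorm (\<lambda>N. {1..2^N}) k (mult_derivative h (\<lambda>n. complex_of_real (g n))) ^ 2^k
      = of_real (l h)" if "h \<ge> 1" for h
    using Suc.IH[OF l[OF that]] by simp
  then have "(\<lambda>H. (\<Sum>h=1..H. uniformity_seminorm (\<lambda>N. {1..2^N}) k
        (mult_derivative h (\<lambda>n. complex_of_real (g n))) ^ 2^k) / of_nat H)
      = (\<lambda>H. complex_of_real ((\<Sum>h=1..H. l h) / real H))"
    by (simp add: fun_eq_iff)
  then show ?case
    unfolding uniformity_seminorm_Suc_power using tendsto_of_real[OF L, where 'a=complex]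
    by (simp only: limI)
qed

section \<open>The Thue--Morse sequence\<close>

fun tm :: "nat \<Rightarrow> real" where
  "tm n = (if n = 0 then 1 else (if odd n then -1 else 1) * tm (n div 2))"

declare tm.simps [simp del]

lemma tm_0 [simp]: "tm 0 = 1"
  by (simp add: tm.simps)

lemma tm_step: "tm n = (if odd n then -1 else 1) * tm (n div 2)"
  by (cases "n = 0") (simp_all add: tm.simps[of n])

lemma tm_1 [simp]: "tm (Suc 0) = -1"
  by (simp add: tm.simps)

lemma tm_cases: "tm n = 1 \<or> tm n = -1"
proof (induction n rule: less_induct)
  case (less n)
  show ?case
  proof (cases "n = 0")
    case False
    then have "tm (n div 2) = 1 \<or> tm (n div 2) = -1" by (intro less.IH) simp
    then show ?thesis unfolding tm_step[of n] by auto
  qed simp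
qed

lemma abs_tm [simp]: "\<bar>tm n\<bar> = 1"
  using tm_cases[of n] by auto

lemma tm_sq [simp]: "tm n * tm n = 1"
  using tm_cases[of n] by auto

text \<open>The binary digits of \<open>a\<close> lie below position \<open>l\<close> and those of
  \<open>2^l * b\<close> do not, so there is no carry and the digit sums add.\<close>

lemma tm_add:
  assumes "a < 2^l"
  shows "tm (a + 2^l * b) = tm a * tm b"
  using assms
proof (induction l arbitrary: a)
  case (Suc l)
  have "(a + 2 ^ Suc l * b) div 2 = a div 2 + 2^l * b" by simp
  moreover have "a div 2 < 2^l" using Suc.prems by auto
  ultimately show ?case
    using Suc.IH[of "a div 2"] tm_step[of "a + 2 ^ Suc l * b"] tm_step[of a] by simp
qed simp

lemma tm_pow2: "tm (2^l) = -1"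
  using tm_add[of 0 l 1] by simp

definition tmp :: "nat \<Rightarrow> nat \<Rightarrow> real" where
  "tmp m n = tm (n mod 2^m)"

lemma tmp_periodic: "tmp m (n + 2^m) = tmp m n"
  by (simp add: tmp_def)

lemma bdd1_tm: "bdd1 tm" and bdd1_tmp: "bdd1 (tmp m)"
  by (simp_all add: bdd1_def tmp_def)

text \<open>\<open>z\<close> may reach beyond \<open>2^l\<close>; its quotient is the carry into the
  high digits \<open>y\<close>.\<close>

lemma tmp_split: "tmp (l + m) (z + 2^l * y) = tm (z mod 2^l) * tmp m (y + z div 2^l)"
proof -
  have "(z + 2^l * y) mod 2^(l+m) = 2^l * ((z + 2^l * y) div 2^l mod 2^m) + (z + 2^l * y) mod 2^l"
    by (simp only: power_add mod_mult2_eq)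
  also have "\<dots> = z mod 2^l + 2^l * ((y + z div 2^l) mod 2^m)"
    by (simp add: add.commute)
  finally show ?thesis unfolding tmp_def by (simp add: tm_add)
qed

lemma near_mono: "near \<epsilon> g p \<Longrightarrow> \<epsilon> \<le> \<epsilon>' \<Longrightarrow> near \<epsilon>' g p"
  unfolding near_def by (auto elim!: eventually_mono)

text \<open>The high part of \<open>n\<close> gives the same sign to \<open>tm n\<close> and
  \<open>tm (n + h)\<close>, and this sign cancels unless adding \<open>h\<close> carries past the
  lowest \<open>m\<close> digits. At most \<open>h\<close> residues do so, each with error at most
  2.\<close>

lemma near_rderiv_tm: "near (2 * real h / 2^m) (rderiv h tm) (rderiv h (tmp m))"
proof -
  define u where "u n = (if n mod 2^m + h \<ge> 2^m then 2 else 0 :: real)" for n :: nat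
  have le: "\<bar>rderiv h tm n - rderiv h (tmp m) n\<bar> \<le> u n" for n
  proof (cases "n mod 2^m + h \<ge> 2^m")
    case True
    have "\<bar>rderiv h tm n\<bar> \<le> 1" "\<bar>rderiv h (tmp m) n\<bar> \<le> 1"
      using bdd1_rderiv[OF bdd1_tm] bdd1_rderiv[OF bdd1_tmp] by (auto simp: bdd1_def)
    then show ?thesis using True by (simp add: u_def)
  next
    case False
    define a b where "a = n mod 2^m" and "b = n div 2^m"
    have ab: "n = a + 2^m * b" "a + h < 2^m" using False by (auto simp: a_def b_def)
    have "tm n = tm a * tm b" "tm (n + h) = tm (a + h) * tm b"
      using tm_add[of a m b] tm_add[of "a + h" m b] ab by (simp_all add: algebra_simps)
    moreover have "n + h = a + h + 2^m * b" using ab by simp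
    then have "tmp m n = tm a" "tmp m (n + h) = tm (a + h)"
      using ab by (simp_all only: tmp_def mod_mult_self2) simp_all
    ultimately show ?thesis using tm_sq[of b] by (simp add: rderiv_def u_def False)
  qed
  have "bavg u \<longlonglongrightarrow> cyc 0 (2^m) u"
    using has_unif_periodic[of u m 0] by (simp add: u_def)
  moreover have "cyc 0 (2^m) u \<le> 2 * real h / 2^m"
  proof -
    have "(\<Sum>n<2^m. u n) = (\<Sum>n\<in>{n\<in>{..<2^m}. n + h \<ge> 2^m}. 2)"
      by (rule sum.mono_neutral_cong_right) (auto simp: u_def)
    also have "\<dots> = 2 * card {n\<in>{..<2^m}. n + h \<ge> 2^m}" by simp
    also have "card {n\<in>{..<2^m}. n + h \<ge> 2^m} \<le> card {2^m-h..<2^m}"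
      by (intro card_mono) auto
    also have "\<dots> \<le> h" by simp
    finally show ?thesis by (simp add: divide_right_mono)
  qed
  ultimately have lim: "bavg u \<longlonglongrightarrow> cyc 0 (2^m) u" and le_c: "cyc 0 (2^m) u \<le> 2 * real h / 2^m" .
  have ev: "\<forall>\<^sub>F N in sequentially. bavg u N \<le> 2 * real h / 2^m + \<delta>" if "\<delta> > 0" for \<delta>
  proof -
    have "cyc 0 (2^m) u < 2 * real h / 2^m + \<delta>" using le_c that by linarith
    then have "\<forall>\<^sub>F N in sequentially. bavg u N < 2 * real h / 2^m + \<delta>"
      by (rule order_tendstoD(2)[OF lim])
    then show ?thesis by (rule eventually_mono) simp
  qed
  show ?thesis
    unfolding near_def
  proof (intro allI impI)
    fix \<delta> :: real assume "\<delta> > 0"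
    show "\<forall>\<^sub>F N in sequentially. bavg (\<lambda>n. \<bar>rderiv h tm n - rderiv h (tmp m) n\<bar>) N \<le> 2 * real h / 2^m + \<delta>"
      using ev[OF \<open>\<delta> > 0\<close>] by (rule eventually_mono) (rule order_trans[OF bavg_mono[OF le]])
  qed
qed

lemma limit_periodic_rderiv_tm: "limit_periodic (rderiv h tm)"
  unfolding limit_periodic_def
proof (intro conjI allI impI)
  show "bdd1 (rderiv h tm)" by (intro bdd1_rderiv bdd1_tm)
  fix \<epsilon> :: real assume "\<epsilon> > 0"
  obtain m :: nat where "2 * real h / \<epsilon> < 2^m" using real_arch_pow[of 2] by auto
  then have "2 * real h / 2^m \<le> \<epsilon>" using \<open>\<epsilon> > 0\<close> by (simp add: field_simps)
  then have "near \<epsilon> (rderiv h tm) (rderiv h (tmp m))"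
    using near_rderiv_tm near_mono by blast
  then show "\<exists>m p. bdd1 p \<and> (\<forall>n. p (n + 2^m) = p n) \<and> near \<epsilon> (rderiv h tm) p"
    by (intro exI[of _ m] exI[of _ "rderiv h (tmp m)"])
       (auto intro!: bdd1_rderiv bdd1_tmp rderiv_periodic tmp_periodic)
qed

section \<open>Cyclic Gowers averages\<close>

text \<open>The sum over \<open>h\<close> runs through a full period whatever \<open>n\<close> is,
  so the double sum factors.\<close>

lemma cyc_1_periodic:
  assumes "\<And>n. p (n + Q) = p n"
  shows "cyc (Suc 0) Q p = (cyc 0 Q p)\<^sup>2"
proof -
  have "(\<Sum>h<Q. \<Sum>n<Q. p n * p (n + h)) = (\<Sum>n<Q. p n * (\<Sum>h<Q. p (n + h)))"
    by (subst sum.swap) (simp add: sum_distrib_left)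
  also have "\<dots> = (\<Sum>n<Q. p n * (\<Sum>h<Q. p h))"
  proof (intro sum.cong refl)
    fix n
    have "(\<Sum>h<Q. p (n + h)) = (\<Sum>h=n..<n+Q. p h)"
      using sum.shift_bounds_nat_ivl[of p 0 n Q] by (simp add: lessThan_atLeast0 add.commute)
    then show "p n * (\<Sum>h<Q. p (n + h)) = p n * (\<Sum>h<Q. p h)"
      using sum_periodic_window[of p Q n, OF assms] by simp
  qed
  also have "\<dots> = (\<Sum>h<Q. p h)\<^sup>2"
    by (simp add: sum_distrib_right power2_eq_square)
  finally show ?thesis
    by (simp add: rderiv_def power_divide sum_divide_distrib[symmetric] power2_eq_square)
qed

text \<open>Level 1 is a square, and each later level averages values of the level before
  it.\<close>

lemma cyc_Suc_nonneg:
  assumes "\<And>n. p (n + Q) = p n"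
  shows "0 \<le> cyc (Suc k) Q p"
  using assms
proof (induction k arbitrary: p)
  case 0
  then show ?case by (simp only: cyc_1_periodic zero_le_power2)
next
  case (Suc k)
  then have "0 \<le> cyc (Suc k) Q (rderiv h p)" for h
    by (intro Suc.IH rderiv_periodic)
  then show ?case by (subst cyc.simps(2)) (intro divide_nonneg_nonneg sum_nonneg; simp)
qed

text \<open>A vertex of the cube with base point \<open>x 0\<close> and sides \<open>x 1\<close>,
  ..., \<open>x k\<close>: for \<open>v < 2^k\<close>, bit \<open>j\<close> of \<open>v\<close>
  decides whether \<open>x (Suc j)\<close> is added.\<close>

fun lin :: "nat \<Rightarrow> nat \<Rightarrow> (nat \<Rightarrow> nat) \<Rightarrow> nat" where
  "lin 0 v x = x 0"
| "lin (Suc k) v x = (if v < 2^k then lin k v x else lin k (v - 2^k) x + x (Suc k))"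

lemma lin_cong: "(\<And>i. i \<le> k \<Longrightarrow> x i = y i) \<Longrightarrow> lin k v x = lin k v y"
  by (induction k v x rule: lin.induct) auto

lemma lin_add: "lin k v (\<lambda>i. x i + c * y i) = lin k v x + c * lin k v y"
  by (induction k arbitrary: v) (auto simp: algebra_simps)

lemma lin_le: "(\<And>i. i \<le> k \<Longrightarrow> x i \<le> b) \<Longrightarrow> lin k v x \<le> (k + 1) * b"
proof (induction k arbitrary: v)
  case (Suc k)
  have "lin k w x \<le> (k + 1) * b" for w using Suc by simp
  from this[of v] this[of "v - 2^k"] Suc.prems[of "Suc k"] show ?case by auto
qed simp

lemma lin_add_0: "lin k v (x(0 := x 0 + c)) = lin k v x + c"
  by (induction k arbitrary: v) auto

lemma prod_lessThan_double:
  fixes f :: "nat \<Rightarrow> real"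
  shows "(\<Prod>v<2^Suc k. f v) = (\<Prod>v<2^k. f v) * (\<Prod>v<2^k. f (v + 2^k))"
proof -
  have "(\<Prod>v<a+b. f v) = (\<Prod>v<a. f v) * (\<Prod>v<b. f (v + a))" for a b :: nat
    by (induction b) (simp_all add: add.commute)
  from this[of "2^k" "2^k"] show ?thesis by (simp add: mult_2)
qed

lemma sum_PiE_insert:
  assumes "i \<notin> I"
  shows "(\<Sum>x\<in>PiE (insert i I) (\<lambda>_. S). f x) = (\<Sum>a\<in>S. \<Sum>x\<in>PiE I (\<lambda>_. S). f (x(i := a)))"
proof -
  have "(\<Sum>x\<in>PiE (insert i I) (\<lambda>_. S). f x) = (\<Sum>(a, x)\<in>S \<times> PiE I (\<lambda>_. S). f (x(i := a)))"
    unfolding PiE_insert_eq by (subst sum.reindex[OF inj_combinator[OF assms]])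
      (simp add: case_prod_unfold)
  then show ?thesis by (simp add: sum.cartesian_product)
qed

text \<open>Unrolling the recursion, the shift of each derivative becomes a new coordinate, and the
  two halves of the product over \<open>v < 2^Suc k\<close> are opposite faces of the cube.\<close>

lemma cyc_eq_sum:
  "cyc k Q p = (\<Sum>x\<in>PiE {..k} (\<lambda>_. {..<Q}). \<Prod>v<2^k. p (lin k v x)) / real Q ^ (k + 1)"
proof (induction k arbitrary: p)
  case 0
  have "{..0::nat} = insert 0 {}" by auto
  then show ?case by (simp add: sum_PiE_insert)
next
  case (Suc k)
  have "(\<Sum>x\<in>PiE {..Suc k} (\<lambda>_. {..<Q}). \<Prod>v<2^Suc k. p (lin (Suc k) v x))
     = (\<Sum>h<Q. \<Sum>x\<in>PiE {..k} (\<lambda>_. {..<Q}). \<Prod>v<2^k. rderiv h p (lin k v x))"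
    unfolding atMost_Suc
  proof (subst sum_PiE_insert, simp, intro sum.cong refl)
    fix h x
    have "lin k v (x(Suc k := h)) = lin k v x" for v
      by (rule lin_cong) simp
    then show "(\<Prod>v<2^Suc k. p (lin (Suc k) v (x(Suc k := h)))) = (\<Prod>v<2^k. rderiv h p (lin k v x))"
      by (simp only: prod_lessThan_double) (simp add: rderiv_def prod.distrib)
  qed
  then show ?case
    by (simp add: Suc.IH sum_divide_distrib[symmetric] field_simps)
qed

lemma sum_mixed_radix:
  fixes f :: "nat \<Rightarrow> real"
  shows "(\<Sum>c<a*b. f c) = (\<Sum>s<a. \<Sum>t<b. f (s + a * t))"
proof -
  have *: "s + a * t < a * b" if "s < a" "t < b" for s t
  proof -
    have "s + a * t < a * Suc t" using that by simp
    also have "\<dots> \<le> a * b" using that by (intro mult_le_mono2) simp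
    finally show ?thesis .
  qed
  have "(\<Sum>c<a*b. f c) = (\<Sum>(s,t)\<in>{..<a} \<times> {..<b}. f (s + a * t))"
    by (rule sum.reindex_bij_witness[of _ "\<lambda>(s,t). s + a * t" "\<lambda>c. (c mod a, c div a)"])
       (use * in \<open>auto simp: less_mult_imp_div_less mult.commute intro!: mod_less_divisor gr0I\<close>)
  then show ?thesis by (simp add: sum.cartesian_product)
qed

text \<open>Coordinatewise division with remainder. The congruence assumption matters because
  \<open>lo i + a * hi i\<close> need not be the default value that \<open>PiE\<close> prescribes
  outside \<open>I\<close>.\<close>

lemma sum_PiE_mixed_radix:
  fixes F :: "('i \<Rightarrow> nat) \<Rightarrow> real"
  assumes "finite I" "\<And>x y. (\<And>i. i \<in> I \<Longrightarrow> x i = y i) \<Longrightarrow> F x = F y"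
  shows "(\<Sum>x\<in>PiE I (\<lambda>_. {..<a*b}). F x) =
    (\<Sum>lo\<in>PiE I (\<lambda>_. {..<a}). \<Sum>hi\<in>PiE I (\<lambda>_. {..<b}). F (\<lambda>i. lo i + a * hi i))"
  using assms
proof (induction I arbitrary: F rule: finite_induct)
  case empty
  then show ?case by simp
next
  case (insert i I)
  have upd: "(\<lambda>j. lo j + a * hi j)(i := s + a * t) = (\<lambda>j. (lo(i := s)) j + a * (hi(i := t)) j)"
    for lo hi s t by auto
  have "(\<Sum>x\<in>PiE (insert i I) (\<lambda>_. {..<a*b}). F x)
      = (\<Sum>c<a*b. \<Sum>x\<in>PiE I (\<lambda>_. {..<a*b}). F (x(i := c)))"
    by (rule sum_PiE_insert) fact
  also have "\<dots> = (\<Sum>c<a*b. \<Sum>lo\<in>PiE I (\<lambda>_. {..<a}). \<Sum>hi\<in>PiE I (\<lambda>_. {..<b}).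
      F ((\<lambda>j. lo j + a * hi j)(i := c)))"
    by (intro sum.cong refl insert.IH insert.prems) auto
  also have "\<dots> = (\<Sum>s<a. \<Sum>t<b. \<Sum>lo\<in>PiE I (\<lambda>_. {..<a}). \<Sum>hi\<in>PiE I (\<lambda>_. {..<b}).
      F (\<lambda>j. (lo(i := s)) j + a * (hi(i := t)) j))"
    by (simp only: sum_mixed_radix upd)
  also have "\<dots> = (\<Sum>s<a. \<Sum>lo\<in>PiE I (\<lambda>_. {..<a}). \<Sum>t<b. \<Sum>hi\<in>PiE I (\<lambda>_. {..<b}).
      F (\<lambda>j. (lo(i := s)) j + a * (hi(i := t)) j))"
    by (intro sum.cong refl sum.swap)
  also have "\<dots> = (\<Sum>lo\<in>PiE (insert i I) (\<lambda>_. {..<a}). \<Sum>hi\<in>PiE (insert i I) (\<lambda>_. {..<b}).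
      F (\<lambda>j. lo j + a * hi j))"
    by (simp only: sum_PiE_insert[OF insert.hyps(2)])
  finally show ?case .
qed

section \<open>Renormalisation of the cube averages\<close>

definition tcube :: "nat \<Rightarrow> (nat \<Rightarrow> nat) \<Rightarrow> (nat \<Rightarrow> nat) \<Rightarrow> real" where
  "tcube k r x = (\<Prod>v<2^k. tm (lin k v x + r v))"

text \<open>With all shifts 0 this is \<open>cyc k (2^m) (tmp m)\<close>. The shifts depend on the
  vertex because low digits send different carries to different vertices.\<close>

definition tavg :: "nat \<Rightarrow> nat \<Rightarrow> (nat \<Rightarrow> nat) \<Rightarrow> real" where
  "tavg k m r =
     (\<Sum>x\<in>PiE {..k} (\<lambda>_. {..<2^m}). \<Prod>v<2^k. tmp m (lin k v x + r v)) / (2^m)^(k + 1)"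

section \<open>Sign changes of the cube products\<close>

lemma tcube_cases: "tcube k r x = 1 \<or> tcube k r x = -1"
proof -
  have "(\<Prod>v\<in>S. tm (f v)) = 1 \<or> (\<Prod>v\<in>S. tm (f v)) = -1" if "finite S" for S and f :: "nat \<Rightarrow> nat"
    using that
  proof induction
    case (insert a S)
    then show ?case using tm_cases[of "f a"] by auto
  qed simp
  then show ?thesis by (simp add: tcube_def)
qed

lemma tcube_cong: "(\<And>i. i \<le> k \<Longrightarrow> x i = y i) \<Longrightarrow> tcube k r x = tcube k r y"
  unfolding tcube_def by (intro prod.cong refl arg_cong[of _ _ tm] arg_cong2[of _ _ _ _ "(+)"] lin_cong)

lemma tcube_Suc:
  "tcube (Suc k) r x = tcube k r x * tcube k (\<lambda>v. r (v + 2^k)) (x(0 := x 0 + x (Suc k)))"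
  unfolding tcube_def prod_lessThan_double by (simp add: lin_add_0 algebra_simps)

text \<open>Taking \<open>n + r\<close> to be a power of 2 above \<open>2^j\<close> gives digit sum
  1, and adding \<open>2^j\<close> makes it 2.\<close>

lemma tm_not_periodic: "\<exists>n\<ge>N0. tm (n + 2^j + r) \<noteq> tm (n + r)"
proof -
  define b where "b = N0 + r + Suc j"
  have "(2::nat)^Suc j \<le> 2^b" by (intro power_increasing) (auto simp: b_def)
  have "b < 2^b" by simp
  define n where "n = 2^b - r"
  have "n \<ge> N0" "n + r = 2^b" using \<open>b < 2^b\<close> by (auto simp: n_def b_def)
  moreover have "tm (2^j + 2^b) = 1"
  proof -
    have "(2::nat)^b = 2^Suc j * 2^(b - Suc j)"
      unfolding power_add[symmetric] by (simp add: b_def)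
    then have "tm (2^j + 2^b) = tm (2^j) * tm (2^(b - Suc j))"
      using tm_add[of "2^j" "Suc j" "2^(b - Suc j)"] by simp
    then show ?thesis by (simp add: tm_pow2)
  qed
  moreover have "n + 2^j + r = 2^j + 2^b" using \<open>n + r = 2^b\<close> by simp
  ultimately have "tm (n + 2^j + r) = 1" "tm (n + r) = -1" by (simp_all only: tm_pow2)
  then show ?thesis using \<open>n \<ge> N0\<close> by (intro exI[of _ n]) simp
qed

text \<open>If a cube product of dimension \<open>k + 1\<close> were \<open>2^j\<close>-periodic in its base point, then separating
  the two faces shows that one face is \<open>2^(j + 1)\<close>-periodic; hence the statement for all \<open>j\<close> at once.\<close>

lemma tcube_not_periodic:
  "\<exists>h. \<exists>n\<ge>N0. tcube k r (h(0 := n + 2^j)) \<noteq> tcube k r (h(0 := n))"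
proof (induction k arbitrary: r j)
  case 0
  then show ?case using tm_not_periodic[of N0 j "r 0"] by (simp add: tcube_def)
next
  case (Suc k)
  define r' where "r' = (\<lambda>v. r (v + 2^k))"
  obtain h n0 where n0: "n0 \<ge> N0" "tcube k r' (h(0 := n0 + 2^Suc j)) \<noteq> tcube k r' (h(0 := n0))"
    using Suc.IH by blast
  define f g where "f n = tcube k r (h(0 := n))" and "g n = tcube k r' (h(0 := n))" for n
  have f: "f n = 1 \<or> f n = -1" and g: "g n = 1 \<or> g n = -1" for n
    using tcube_cases by (auto simp: f_def g_def)
  show ?case
  proof (rule ccontr)
    assume "\<not> ?thesis"
    then have per: "tcube (Suc k) r (h'(0 := n + 2^j)) = tcube (Suc k) r (h'(0 := n))"
      if "n \<ge> N0" for h' n using that by blast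
    have eq: "tcube (Suc k) r ((h(Suc k := s))(0 := n)) = f n * g (n + s)" for n s
    proof -
      have "tcube k r ((h(Suc k := s))(0 := n)) = f n"
        unfolding f_def by (rule tcube_cong) auto
      moreover have "tcube k r' ((h(Suc k := s))(0 := n + s)) = g (n + s)"
        unfolding g_def by (rule tcube_cong) auto
      ultimately show ?thesis by (simp add: tcube_Suc r'_def)
    qed
    have fg: "f (N0 + 2^j) * g (N0 + 2^j + s) = f N0 * g (N0 + s)" for s
      using per[of N0 "h(Suc k := s)"] eq[of s] by simp
    \<comment> \<open>Choosing \<open>s = y - N0\<close> turns the relation at the fixed base point
      \<open>N0\<close> into one at every \<open>y \<ge> N0\<close>. The factor is a sign
      independent of \<open>y\<close>, so two steps of \<open>2^j\<close> cancel it.\<close>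
    have gg: "g (y + 2^j) = f N0 * f (N0 + 2^j) * g y" if "y \<ge> N0" for y
    proof -
      have "N0 + 2^j + (y - N0) = y + 2^j" "N0 + (y - N0) = y" using that by auto
      then have "f (N0 + 2^j) * g (y + 2^j) = f N0 * g y" using fg[of "y - N0"] by metis
      then show ?thesis using f[of N0] f[of "N0 + 2^j"] by auto
    qed
    have "g (n0 + 2^j + 2^j) = g n0"
      using gg[of n0] gg[of "n0 + 2^j"] n0(1) f[of N0] f[of "N0 + 2^j"] by auto
    then show False using n0(2) by (simp add: g_def mult_2 add.assoc)
  qed
qed

lemma tcube_both_signs: "\<exists>x y. tcube k r x = 1 \<and> tcube k r y = -1"
  using tcube_not_periodic[of 0 k r 0] tcube_cases by metis

section \<open>Digit splitting, carries and the contraction estimate\<close>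

definition small_shift :: "nat \<Rightarrow> (nat \<Rightarrow> nat) \<Rightarrow> bool" where
  "small_shift k r \<longleftrightarrow> (\<forall>v. r v \<le> k + 1)"

text \<open>Each coordinate is written as \<open>l\<close> low digits plus \<open>2^l\<close> times
  \<open>m\<close> high digits. For fixed low digits, \<open>tmp_split\<close> leaves a sign times
  an average of the same kind, whose shifts are the carries.\<close>

lemma tavg_split:
  "tavg k (l + m) r = (\<Sum>x\<in>PiE {..k} (\<lambda>_. {..<2^l}).
     (\<Prod>v<2^k. tm ((lin k v x + r v) mod 2^l)) * tavg k m (\<lambda>v. (lin k v x + r v) div 2^l))
     / (2^l)^(k + 1)"
proof -
  define F where "F x = (\<Prod>v<2^k. tmp (l + m) (lin k v x + r v))" for x
  have F: "F x = F y" if "\<And>i. i \<in> {..k} \<Longrightarrow> x i = y i" for x y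
    using lin_cong[of k x y] that by (simp add: F_def)
  have split: "F (\<lambda>i. x i + 2^l * y i) = (\<Prod>v<2^k. tm ((lin k v x + r v) mod 2^l)) *
      (\<Prod>v<2^k. tmp m (lin k v y + (lin k v x + r v) div 2^l))" for x y
  proof -
    have "lin k v x + 2^l * lin k v y + r v = (lin k v x + r v) + 2^l * lin k v y" for v by simp
    then show ?thesis
      by (simp only: F_def lin_add tmp_split prod.distrib)
  qed
  have "(\<Sum>x\<in>PiE {..k} (\<lambda>_. {..<2^(l+m)}). F x) = (\<Sum>x\<in>PiE {..k} (\<lambda>_. {..<2^l}).
      \<Sum>y\<in>PiE {..k} (\<lambda>_. {..<2^m}). F (\<lambda>i. x i + 2^l * y i))"
    unfolding power_add by (rule sum_PiE_mixed_radix[OF finite_atMost F])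
  also have "\<dots> = (\<Sum>x\<in>PiE {..k} (\<lambda>_. {..<2^l}). (\<Prod>v<2^k. tm ((lin k v x + r v) mod 2^l)) *
      (tavg k m (\<lambda>v. (lin k v x + r v) div 2^l) * (2^m)^(k + 1)))"
    by (simp add: split tavg_def sum_distrib_left)
  also have "\<dots> = (\<Sum>x\<in>PiE {..k} (\<lambda>_. {..<2^l}). (\<Prod>v<2^k. tm ((lin k v x + r v) mod 2^l)) *
      tavg k m (\<lambda>v. (lin k v x + r v) div 2^l)) * (2^m)^(k + 1)"
    by (simp add: sum_distrib_right mult.assoc)
  finally show ?thesis
    by (simp add: tavg_def F_def power_add power_mult_distrib)
qed

text \<open>The bound \<open>k + 1\<close> reproduces itself: a vertex has at most
  \<open>k + 1\<close> summands, each at most \<open>2^l - 1\<close>, so together with its shift it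
  is at most \<open>(k + 1) * 2^l\<close>, whatever \<open>l\<close> is.\<close>

lemma small_shift_carry:
  assumes "small_shift k r" "x \<in> PiE {..k} (\<lambda>_. {..<2^l})"
  shows "small_shift k (\<lambda>v. (lin k v x + r v) div 2^l)"
  unfolding small_shift_def
proof
  fix v
  have "x i \<le> 2^l - 1" if "i \<le> k" for i
  proof -
    have "x i < 2^l" using assms(2) that by (auto simp: PiE_iff)
    then show ?thesis by simp
  qed
  then have "lin k v x \<le> (k + 1) * (2^l - 1)" by (rule lin_le)
  moreover have "r v \<le> k + 1" using assms(1) by (simp add: small_shift_def)
  ultimately have "lin k v x + r v \<le> (k + 1) * (2^l - 1) + (k + 1) * 1" by simp
  also have "\<dots> = (k + 1) * 2^l"
    by (simp only: distrib_left[symmetric]) simp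
  finally show "(lin k v x + r v) div 2^l \<le> k + 1"
    by (metis div_le_mono nonzero_mult_div_cancel_right power_not_zero zero_neq_numeral)
qed

lemma abs_prod_tm: "\<bar>\<Prod>v\<in>S. tm (f v)\<bar> = 1"
  by (simp add: abs_prod)

lemma card_cube: "card (PiE {..k} (\<lambda>_. {..<2^l::nat})) = (2^l)^(k + 1)"
  by (simp add: card_PiE)

text \<open>Each term of \<open>tavg_split\<close> is a sign times an average with small shifts, so
  a uniform bound at one level persists at every higher level.\<close>

lemma tavg_bound_step:
  assumes "\<And>r. small_shift k r \<Longrightarrow> \<bar>tavg k m r\<bar> \<le> B" "small_shift k r"
  shows "\<bar>tavg k (l + m) r\<bar> \<le> B"
proof -
  have "\<bar>\<Sum>x\<in>PiE {..k} (\<lambda>_. {..<2^l}).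
     (\<Prod>v<2^k. tm ((lin k v x + r v) mod 2^l)) * tavg k m (\<lambda>v. (lin k v x + r v) div 2^l)\<bar>
     \<le> (\<Sum>x\<in>PiE {..k} (\<lambda>_. {..<2^l::nat}). B)"
    by (rule order_trans[OF sum_abs], rule sum_mono)
       (simp add: abs_mult abs_prod_tm assms small_shift_carry)
  also have "\<dots> = (2^l)^(k + 1) * B" by (simp only: sum_constant card_cube) simp
  finally show ?thesis
    by (simp only: tavg_split[of k l m r] abs_divide) (simp add: field_simps)
qed

text \<open>Two low-digit vectors without carries and with opposite signs contribute opposite multiples
  of the same average, so these two terms cancel.\<close>

lemma tavg_contraction_step:
  assumes B: "\<And>r. small_shift k r \<Longrightarrow> \<bar>tavg k m r\<bar> \<le> B" and r: "small_shift k r"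
    and x: "x \<in> PiE {..k} (\<lambda>_. {..<2^l})" "tcube k r x = 1" "\<And>v. v < 2^k \<Longrightarrow> lin k v x + r v < 2^l"
    and y: "y \<in> PiE {..k} (\<lambda>_. {..<2^l})" "tcube k r y = -1" "\<And>v. v < 2^k \<Longrightarrow> lin k v y + r v < 2^l"
  shows "\<bar>tavg k (l + m) r\<bar> \<le> (1 - 2 / (2^l)^(k + 1)) * B"
proof -
  define P where "P = PiE {..k} (\<lambda>_. {..<2^l::nat})"
  define T where "T x = (\<Prod>v<2^k. tm ((lin k v x + r v) mod 2^l)) *
    tavg k m (\<lambda>v. (lin k v x + r v) div 2^l)" for x
  \<comment> \<open>Absence of carries makes the new shifts vanish only at the vertices
    \<open>v < 2^k\<close>, and \<open>tavg\<close> reads no other shifts.\<close>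
  have cong: "tavg k m r1 = tavg k m r2" if "\<And>v. v < 2^k \<Longrightarrow> r1 v = r2 v" for r1 r2
    using that by (simp add: tavg_def)
  have "T z = tcube k r z * tavg k m (\<lambda>_. 0)" if "\<And>v. v < 2^k \<Longrightarrow> lin k v z + r v < 2^l" for z
    using that by (auto simp: T_def tcube_def intro!: arg_cong2[of _ _ _ _ "(*)"] cong prod.cong)
  from this[of x] this[of y] x y have xy: "T x + T y = 0" by simp
  have "x \<noteq> y" using x y by auto
  have fin: "finite P" by (auto simp: P_def intro: finite_PiE)
  have "sum T P = sum T (P - {x, y}) + sum T {x, y}"
    using x y fin by (intro sum.subset_diff) (auto simp: P_def)
  also have "sum T {x, y} = 0" using xy \<open>x \<noteq> y\<close> by simp
  finally have "\<bar>sum T P\<bar> \<le> (\<Sum>z\<in>P - {x, y}. \<bar>T z\<bar>)" by (simp add: sum_abs)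
  also have "\<dots> \<le> (\<Sum>z\<in>P - {x, y}. B)"
    by (rule sum_mono) (simp add: T_def P_def abs_mult abs_prod_tm B small_shift_carry[OF r])
  also have "\<dots> = real (card (P - {x, y})) * B" by simp
  also have "card (P - {x, y}) = (2^l)^(k + 1) - 2"
    using x y \<open>x \<noteq> y\<close> by (subst card_Diff_subset) (auto simp: P_def card_cube)
  also have "2 \<le> ((2::nat)^l)^(k + 1)"
    using card_mono[OF fin, of "{x, y}"] x y \<open>x \<noteq> y\<close> unfolding P_def card_cube by simp
  then have "real ((2^l)^(k + 1) - 2) = (2^l)^(k + 1) - 2" by (simp add: of_nat_diff)
  finally have "\<bar>sum T P\<bar> \<le> ((2^l)^(k + 1) - 2) * B" .
  then have "\<bar>sum T P\<bar> / (2^l)^(k + 1) \<le> ((2^l)^(k + 1) - 2) * B / (2^l)^(k + 1)"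
    by (rule divide_right_mono) simp
  also have "\<dots> = (1 - 2 / (2^l)^(k + 1)) * B" by (simp add: field_simps)
  finally show ?thesis
    by (simp only: tavg_split[of k l m r] abs_divide T_def[symmetric] P_def[symmetric]) simp
qed

text \<open>A fixed pair of opposite signs fits into every sufficiently large box. Having all
  \<open>l \<ge> l0\<close> allows a single level to serve many shifts at once.\<close>

lemma ex_sign_witness_level:
  "\<exists>l0. \<forall>l\<ge>l0. \<exists>x y. x \<in> PiE {..k} (\<lambda>_. {..<2^l}) \<and> tcube k r x = 1 \<and>
     (\<forall>v<2^k. lin k v x + r v < 2^l) \<and> y \<in> PiE {..k} (\<lambda>_. {..<2^l}) \<and> tcube k r y = -1 \<and>
     (\<forall>v<2^k. lin k v y + r v < 2^l)"
proof -
  obtain x y where xy: "tcube k r x = 1" "tcube k r y = -1"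
    using tcube_both_signs by blast
  have ev: "\<exists>l0. \<forall>l\<ge>l0. restrict z {..k} \<in> PiE {..k} (\<lambda>_. {..<2^l}) \<and>
     (\<forall>v<2^k. lin k v (restrict z {..k}) + r v < 2^l)" for z :: "nat \<Rightarrow> nat"
  proof -
    \<comment> \<open>This sum dominates every coordinate and every shifted vertex, and
      \<open>l < 2^l\<close>.\<close>
    define l0 where "l0 = (\<Sum>i\<le>k. z i) + (\<Sum>v<2^k. lin k v (restrict z {..k}) + r v)"
    have "z i < 2^l" if "l \<ge> l0" "i \<le> k" for l i
    proof -
      have "z i \<le> (\<Sum>i\<le>k. z i)" using that by (intro member_le_sum) auto
      also have "\<dots> \<le> l" using that by (simp add: l0_def)
      finally show ?thesis using less_exp[of l] by linarith
    qed
    moreover have "lin k v (restrict z {..k}) + r v < 2^l" if "l \<ge> l0" "v < 2^k" for l v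
    proof -
      have "lin k v (restrict z {..k}) + r v \<le> (\<Sum>v<2^k. lin k v (restrict z {..k}) + r v)"
        using that by (intro member_le_sum[of v _ "\<lambda>v. lin k v (restrict z {..k}) + r v"]) auto
      also have "\<dots> \<le> l" using that by (simp add: l0_def)
      finally show ?thesis using less_exp[of l] by linarith
    qed
    ultimately show ?thesis by (intro exI[of _ l0]) auto
  qed
  obtain l1 where l1: "\<forall>l\<ge>l1. restrict x {..k} \<in> PiE {..k} (\<lambda>_. {..<2^l}) \<and>
     (\<forall>v<2^k. lin k v (restrict x {..k}) + r v < 2^l)" using ev by blast
  obtain l2 where l2: "\<forall>l\<ge>l2. restrict y {..k} \<in> PiE {..k} (\<lambda>_. {..<2^l}) \<and>
     (\<forall>v<2^k. lin k v (restrict y {..k}) + r v < 2^l)" using ev by blast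
  have "tcube k r (restrict z {..k}) = tcube k r z" for z
    by (rule tcube_cong) simp
  then show ?thesis using l1 l2 xy
    by (intro exI[of _ "max l1 l2"] allI impI exI[of _ "restrict x {..k}"] exI[of _ "restrict y {..k}"]) auto
qed

text \<open>Only finitely many patterns of small shifts occur on the \<open>2^k\<close> vertices.
  The sum of their thresholds is a level that works for all of them, and it gives a common
  rate.\<close>

lemma tavg_contraction:
  "\<exists>l \<rho>. 0 \<le> \<rho> \<and> \<rho> < 1 \<and> (\<forall>m B. (\<forall>r. small_shift k r \<longrightarrow> \<bar>tavg k m r\<bar> \<le> B) \<longrightarrow>
     (\<forall>r. small_shift k r \<longrightarrow> \<bar>tavg k (l + m) r\<bar> \<le> \<rho> * B))"
proof -
  define R where "R = PiE {..<2^k::nat} (\<lambda>_. {..k + 1})"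
  have "finite R" unfolding R_def by (intro finite_PiE) auto
  define W where "W r l x y \<longleftrightarrow> x \<in> PiE {..k} (\<lambda>_. {..<2^l}) \<and> tcube k r x = 1 \<and>
     (\<forall>v<2^k. lin k v x + r v < 2^l) \<and> y \<in> PiE {..k} (\<lambda>_. {..<2^l}) \<and> tcube k r y = -1 \<and>
     (\<forall>v<2^k. lin k v y + r v < 2^l)" for r l x y
  have "\<exists>l0. \<forall>l\<ge>l0. \<exists>x y. W r l x y" for r
    unfolding W_def by (rule ex_sign_witness_level)
  then obtain l0 where l0: "\<And>r l. l \<ge> l0 r \<Longrightarrow> \<exists>x y. W r l x y" by metis
  define l where "l = (\<Sum>r\<in>R. l0 r)"
  define \<rho> :: real where "\<rho> = 1 - 2 / (2^l)^(k + 1)"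
  have wit: "\<exists>x y. W r l x y" if "small_shift k r" for r
  proof -
    \<comment> \<open>Witnesses for the restriction also serve \<open>r\<close>, because
      \<open>W\<close> reads shifts only at \<open>v < 2^k\<close>.\<close>
    have "restrict r {..<2^k} \<in> R" using that by (auto simp: R_def small_shift_def)
    then have "l0 (restrict r {..<2^k}) \<le> l"
      unfolding l_def using \<open>finite R\<close> by (intro member_le_sum) blast+
    then obtain x y where "W (restrict r {..<2^k}) l x y" using l0 by blast
    moreover have "tcube k (restrict r {..<2^k}) z = tcube k r z" for z
      by (simp add: tcube_def)
    ultimately have "W r l x y" by (simp add: W_def)
    then show ?thesis by blast
  qed
  \<comment> \<open>The two witnesses are distinct points of the box, so it has at least two
    elements; this makes \<rho> nonnegative.\<close>
  have "2 \<le> ((2::nat)^l)^(k + 1)"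
  proof -
    obtain x y where xy: "W (\<lambda>_. 0) l x y" using wit[of "\<lambda>_. 0"] by (auto simp: small_shift_def)
    then have "x \<noteq> y" by (auto simp: W_def)
    then have "card {x, y} = 2" by simp
    moreover have "card {x, y} \<le> card (PiE {..k} (\<lambda>_. {..<2^l::nat}))"
      using xy by (intro card_mono finite_PiE) (auto simp: W_def)
    ultimately show ?thesis by (simp only: card_cube)
  qed
  then have "(2::real) \<le> (2^l)^(k + 1)"
    by (metis (mono_tags) of_nat_le_iff of_nat_numeral of_nat_power)
  then have "0 \<le> \<rho>" by (simp add: \<rho>_def)
  moreover have "\<rho> < 1" by (simp add: \<rho>_def)
  moreover have "\<bar>tavg k (l + m) r\<bar> \<le> \<rho> * B"
    if B: "\<forall>r. small_shift k r \<longrightarrow> \<bar>tavg k m r\<bar> \<le> B" and r: "small_shift k r" for m B r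
  proof -
    obtain x y where "W r l x y" using wit[OF r] by blast
    then show ?thesis
      unfolding \<rho>_def W_def using B r by (intro tavg_contraction_step[of k m B r x l y]) auto
  qed
  ultimately show ?thesis by blast
qed

section \<open>Decay of the cyclic averages and vanishing of the Thue--Morse limits\<close>

lemma cyc_tmp_tendsto_0: "(\<lambda>m. cyc k (2^m) (tmp m)) \<longlonglongrightarrow> 0"
proof (rule LIMSEQ_I)
  fix e :: real assume "e > 0"
  obtain l \<rho> where \<rho>: "0 \<le> \<rho>" "\<rho> < 1"
    and step: "\<And>m B r. (\<And>r. small_shift k r \<Longrightarrow> \<bar>tavg k m r\<bar> \<le> B) \<Longrightarrow>
       small_shift k r \<Longrightarrow> \<bar>tavg k (l + m) r\<bar> \<le> \<rho> * B"
    using tavg_contraction[of k] by blast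
  \<comment> \<open>The contraction is iterated from level 0, where the box is a single point and
    \<open>tmp 0\<close> is constantly 1.\<close>
  have pow: "\<bar>tavg k (l * i) r\<bar> \<le> \<rho>^i" if "small_shift k r" for i r
    using that
  proof (induction i arbitrary: r)
    case 0
    have "PiE {..k} (\<lambda>_. {..<2^0::nat}) = {restrict (\<lambda>_. 0) {..k}}"
      by (auto simp: PiE_iff fun_eq_iff extensional_def split: if_splits)
    then have "tavg k 0 r = (\<Prod>v<2^k. tmp 0 (lin k v (restrict (\<lambda>_. 0) {..k}) + r v))"
      by (simp add: tavg_def)
    then show ?case by (simp add: tmp_def)
  next
    case (Suc i)
    then show ?case using step[of "l * i" "\<rho>^i" r] by simp
  qed
  obtain i where i: "\<rho>^i < e"
    using real_arch_pow_inv[OF \<open>e > 0\<close> \<rho>(2)] by blast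
  show "\<exists>n0. \<forall>m\<ge>n0. norm (cyc k (2^m) (tmp m) - 0) < e"
  proof (intro exI allI impI)
    fix m assume "m \<ge> l * i"
    then have m: "m = (m - l * i) + l * i" by simp
    \<comment> \<open>The other \<open>m - l * i\<close> digits merely preserve the bound.\<close>
    have "\<bar>tavg k ((m - l * i) + l * i) (\<lambda>_. 0)\<bar> \<le> \<rho>^i"
      by (rule tavg_bound_step) (auto simp: pow small_shift_def)
    then have "\<bar>tavg k m (\<lambda>_. 0)\<bar> \<le> \<rho>^i" using m by metis
    moreover have "cyc k (2^m) (tmp m) = tavg k m (\<lambda>_. 0)"
      by (simp add: cyc_eq_sum tavg_def)
    ultimately show "norm (cyc k (2^m) (tmp m) - 0) < e" using i by simp
  qed
qed

lemma mean_abs_cyc_tendsto_0: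
  "(\<lambda>m. (\<Sum>h<2^m. \<bar>cyc k (2^m) (rderiv h (tmp m))\<bar>) / 2^m) \<longlonglongrightarrow> 0"
proof (cases k)
  case 0
  have bound: "\<bar>(\<Sum>h<2^m. \<bar>cyc 0 (2^m) (rderiv h (tmp m))\<bar>) / 2^m\<bar> \<le> sqrt (cyc 2 (2^m) (tmp m))" for m
  proof (rule real_le_rsqrt)
    define c where "c h = cyc 0 (2^m) (rderiv h (tmp m))" for h
    have "(\<Sum>h<2^m. \<bar>c h\<bar>)\<^sup>2 \<le> (\<Sum>h<2^m. \<bar>c h\<bar>\<^sup>2) * (\<Sum>h<(2::nat)^m. 1\<^sup>2)"
      using Cauchy_Schwarz_ineq_sum[of "\<lambda>h. \<bar>c h\<bar>" "\<lambda>_. 1" "{..<2^m}"] by simp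
    then have "(\<Sum>h<2^m. \<bar>c h\<bar>)\<^sup>2 \<le> (\<Sum>h<2^m. (c h)\<^sup>2) * 2^m" by simp
    moreover have "cyc 2 (2^m) (tmp m) = (\<Sum>h<2^m. (c h)\<^sup>2) / 2^m"
    proof -
      have "cyc (Suc 0) (2^m) (rderiv h (tmp m)) = (c h)\<^sup>2" for h
        unfolding c_def by (intro cyc_1_periodic rderiv_periodic tmp_periodic)
      then show ?thesis by (subst numeral_2_eq_2, subst cyc.simps(2)) simp
    qed
    ultimately show "\<bar>(\<Sum>h<2^m. \<bar>cyc 0 (2^m) (rderiv h (tmp m))\<bar>) / 2^m\<bar>\<^sup>2 \<le> cyc 2 (2^m) (tmp m)"
      by (simp add: c_def[symmetric] power_divide field_simps power2_eq_square del: cyc.simps)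
  qed
  have "(\<lambda>m. sqrt (cyc 2 (2^m) (tmp m))) \<longlonglongrightarrow> sqrt 0"
    by (intro tendsto_real_sqrt cyc_tmp_tendsto_0)
  then have "(\<lambda>m. sqrt (cyc 2 (2^m) (tmp m))) \<longlonglongrightarrow> 0" by simp
  then show ?thesis unfolding 0
    by (rule Lim_null_comparison[rotated]) (use bound in \<open>auto simp del: cyc.simps\<close>)
next
  case (Suc j)
  have "cyc (Suc j) (2^m) (rderiv h (tmp m)) \<ge> 0" for m h
    by (intro cyc_Suc_nonneg rderiv_periodic tmp_periodic)
  then have "(\<lambda>m. (\<Sum>h<2^m. \<bar>cyc k (2^m) (rderiv h (tmp m))\<bar>) / 2^m) = (\<lambda>m. cyc (Suc k) (2^m) (tmp m))"
    unfolding Suc by (subst (2) cyc.simps(2)) (simp del: cyc.simps)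
  then show ?thesis by (simp only: cyc_tmp_tendsto_0)
qed

text \<open>For \<open>h \<le> H\<close> with \<open>H\<close> a small but fixed proportion of \<open>2^m\<close>, periodising \<open>tm\<close> modulo \<open>2^m\<close>
  costs little, while enlarging the range of \<open>h\<close> to a full period costs only a constant factor.\<close>

lemma has_unif_tm: "has_unif (Suc k) tm 0"
proof -
  have "\<exists>L. has_unif k (rderiv h tm) L" for h
    by (intro limit_periodic_has_unif limit_periodic_rderiv_tm)
  then obtain l where l: "\<And>h. has_unif k (rderiv h tm) (l h)" by metis
  define c where "c m h = cyc k (2^m) (rderiv h (tmp m))" for m h
  define e where "e m = (\<Sum>h<2^m. \<bar>c m h\<bar>) / 2^m" for m
  have e: "e \<longlonglongrightarrow> 0" unfolding e_def c_def by (rule mean_abs_cyc_tendsto_0)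
  have close: "\<bar>l h - c m h\<bar> \<le> 2^k * (2 * real h / 2^m)" for h m
    unfolding c_def
    by (intro has_unif_lipschitz[OF l has_unif_periodic] bdd1_rderiv bdd1_tm bdd1_tmp near_rderiv_tm
        rderiv_periodic tmp_periodic)
  have avg: "\<bar>(\<Sum>h=1..H. l h) / real H\<bar> \<le> 2^(k+1) * (real H / 2^m) + (2^m / real H) * e m"
    if "0 < H" "H < 2^m" for H m
  proof -
    have "\<bar>\<Sum>h=1..H. l h\<bar> \<le> (\<Sum>h=1..H. \<bar>l h\<bar>)" by (rule sum_abs)
    also have "\<dots> \<le> (\<Sum>h=1..H. 2^k * (2 * real H / 2^m) + \<bar>c m h\<bar>)"
    proof (rule sum_mono)
      fix h assume "h \<in> {1..H}"
      then have "2^k * (2 * real h / 2^m) \<le> 2^k * (2 * real H / 2^m)"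
        by (intro mult_left_mono divide_right_mono) auto
      then show "\<bar>l h\<bar> \<le> 2^k * (2 * real H / 2^m) + \<bar>c m h\<bar>" using close[of h m] by linarith
    qed
    also have "\<dots> = real H * (2^(k+1) * (real H / 2^m)) + (\<Sum>h=1..H. \<bar>c m h\<bar>)"
      by (simp add: sum.distrib)
    also have "(\<Sum>h=1..H. \<bar>c m h\<bar>) \<le> (\<Sum>h<2^m. \<bar>c m h\<bar>)"
      using that by (intro sum_mono2) auto
    also have "\<dots> = 2^m * e m" by (simp add: e_def)
    finally have "\<bar>\<Sum>h=1..H. l h\<bar> / real H
        \<le> (real H * (2^(k+1) * (real H / 2^m)) + 2^m * e m) / real H"
      by (intro divide_right_mono) auto
    then show ?thesis using that by (simp add: abs_divide add_divide_distrib)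
  qed
  have "(\<lambda>H. (\<Sum>h=1..H. l h) / real H) \<longlonglongrightarrow> 0"
  proof (rule LIMSEQ_I)
    fix \<epsilon> :: real assume "\<epsilon> > 0"
    \<comment> \<open>First \<open>j\<close> fixes how far the period exceeds \<open>H\<close>; the
      threshold for \<open>e m\<close> then absorbs the factor \<open>2^m / H\<close>.\<close>
    obtain j where j: "(1/2)^j < \<epsilon> / 4 / 2^(k+1)"
      using real_arch_pow_inv[of "\<epsilon> / 4 / 2^(k+1)" "1/2"] \<open>\<epsilon> > 0\<close> by auto
    have "\<epsilon> / 4 / 2^(j+1) > 0" using \<open>\<epsilon> > 0\<close> by simp
    then obtain m0 where m0: "\<And>m. m \<ge> m0 \<Longrightarrow> \<bar>e m\<bar> < \<epsilon> / 4 / 2^(j+1)"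
      using LIMSEQ_D[OF e] by (metis diff_zero real_norm_def)
    show "\<exists>n0. \<forall>H\<ge>n0. norm ((\<Sum>h=1..H. l h) / real H - 0) < \<epsilon>"
    proof (intro exI allI impI)
      fix H :: nat assume H: "H \<ge> 2^m0"
      then have "H > 0" by (metis gr0I le_zero_eq power_not_zero zero_neq_numeral)
      then obtain t where t: "2^t \<le> H" "H < 2^(t+1)"
        using ex_power_ivl1[of 2 H] by auto
      \<comment> \<open>This gives \<open>H / 2^m \<le> (1/2)^j\<close> and
        \<open>2^m / H \<le> 2^(j+1)\<close>, while \<open>H \<ge> 2^m0\<close> ensures
        \<open>m \<ge> m0\<close>.\<close>
      define m where "m = t + 1 + j"
      have "(2::nat)^m0 < 2^(t+1)" using H t by linarith
      then have "m0 < t + 1" by (rule power_less_imp_less_exp[rotated]) simp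
      then have "m \<ge> m0" by (simp add: m_def)
      have "H < 2^(t+1)" "(2::nat)^(t+1) \<le> 2^m" using t by (auto simp: m_def intro: power_increasing)
      then have "H < 2^m" by linarith
      have rt: "real H \<le> 2^(t+1)" "2^t \<le> real H"
        using t by (metis less_imp_le of_nat_le_iff of_nat_numeral of_nat_power)+
      have "real H / 2^m \<le> 2^(t+1) / 2^m" by (intro divide_right_mono rt) simp
      also have "\<dots> = (1/2)^j" by (simp add: m_def power_add power_divide)
      finally have "2^(k+1) * (real H / 2^m) \<le> 2^(k+1) * (\<epsilon> / 4 / 2^(k+1))"
        using j by (intro mult_left_mono) auto
      then have A: "2^(k+1) * (real H / 2^m) \<le> \<epsilon> / 4" by simp
      have "2^m / real H \<le> 2^m / 2^t" using rt \<open>H > 0\<close> by (intro divide_left_mono) auto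
      also have "\<dots> = 2^(j+1)" by (simp add: m_def power_add)
      finally have "(2^m / real H) * e m \<le> 2^(j+1) * (\<epsilon> / 4 / 2^(j+1))"
        using m0[OF \<open>m \<ge> m0\<close>] by (intro mult_mono) (auto simp: e_def intro!: sum_nonneg divide_nonneg_nonneg)
      then have "(2^m / real H) * e m \<le> \<epsilon> / 4" by simp
      then show "norm ((\<Sum>h=1..H. l h) / real H - 0) < \<epsilon>"
        using avg[OF \<open>H > 0\<close> \<open>H < 2^m\<close>] A \<open>\<epsilon> > 0\<close>
        unfolding diff_zero real_norm_def by linarith
    qed
  qed
  then show ?thesis using l by auto
qed

section \<open>Dyadic averages of local functions of the sequence\<close>

text \<open>Flipping the top digit flips the sign. At least one digit must be available, hence
  \<open>Suc N\<close>.\<close>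

lemma sum_tm: "(\<Sum>n<2^Suc N. tm n) = 0"
proof -
  have "(\<Sum>n<(2::nat)^N * 2. tm n) = (\<Sum>s<2^N. \<Sum>t<2. tm (s + 2^N * t))"
    by (rule sum_mixed_radix)
  also have "\<dots> = (\<Sum>s<2^N. \<Sum>t<2. tm s * tm t)"
    by (intro sum.cong refl tm_add) simp
  also have "\<dots> = 0" by (simp add: numeral_2_eq_2)
  finally show ?thesis by (simp add: mult.commute)
qed

lemma bavg_eq: "bavg f N = (\<Sum>n<2^N. f n) / 2^N + (f (2^N) - f 0) / 2^N"
proof -
  have "{1..2^N} \<union> {0} = {..<2^N} \<union> {(2::nat)^N}" by auto
  then have "sum f ({1..2^N} \<union> {0}) = sum f ({..<2^N} \<union> {(2::nat)^N})" by simp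
  then have "(\<Sum>n=1..2^N. f n) + f 0 = (\<Sum>n<2^N. f n) + f (2^N)"
    by (subst (asm) (1 2) sum.union_disjoint) auto
  then show ?thesis by (simp add: bavg_def add_divide_distrib[symmetric] algebra_simps)
qed

lemma inverse_pow2_tendsto_0: "(\<lambda>N. c / 2^N :: real) \<longlonglongrightarrow> 0"
proof -
  have "(\<lambda>N. c * (1/2)^N) \<longlonglongrightarrow> c * (0::real)"
    by (intro tendsto_mult tendsto_const LIMSEQ_power_zero) simp
  then show ?thesis by (simp add: power_divide)
qed

lemma bavg_tm_tendsto_0: "bavg tm \<longlonglongrightarrow> 0"
proof -
  \<comment> \<open>The full sum vanishes, leaving the endpoint difference
    \<open>tm (2^Suc N) - tm 0 = -2\<close>.\<close>
  have "bavg tm (Suc N) = -1 / 2^N" for N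
    using tm_pow2[of "Suc N"] by (simp add: bavg_eq sum_tm del: power_Suc) simp
  then show ?thesis
    using inverse_pow2_tendsto_0[of "-1"] by (subst filterlim_sequentially_Suc[symmetric]) simp
qed

text \<open>A function depending on \<open>tm n, \<dots>, tm (n + K)\<close> only is determined, away from carries, by the
  low digits of \<open>n\<close> and the sign of the high part, and the latter is equidistributed.\<close>

lemma convergent_bavg_local:
  fixes f :: "nat \<Rightarrow> real" and F :: "real \<Rightarrow> nat \<Rightarrow> real"
  assumes range: "\<And>n. 0 \<le> f n" "\<And>n. f n \<le> 1" "\<And>s n. 0 \<le> F s n" "\<And>s n. F s n \<le> 1"
    and loc: "\<And>m s t. s + K < 2^m \<Longrightarrow> f (s + 2^m * t) = F (tm t) s"
  shows "convergent (bavg f)"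
proof (rule convergent_if_near_constants)
  fix e :: real assume "e > 0"
  obtain m where m: "real K / 2^m < e/2"
    using inverse_pow2_tendsto_0[of "real K"] \<open>e > 0\<close>
    by (metis (no_types, lifting) LIMSEQ_D abs_of_nonneg diff_zero divide_nonneg_nonneg half_gt_zero
        of_nat_0_le_iff order_refl real_norm_def zero_le_numeral zero_le_power)
  define c where "c s = (F 1 s + F (-1) s) / 2" for s
  define C where "C = (\<Sum>s<2^m. c s) / 2^m"
  have c: "0 \<le> c s" "c s \<le> 1" for s
    using range(3,4)[of 1 s] range(3,4)[of "-1" s] by (auto simp: c_def)
  have main: "\<bar>(\<Sum>n<2^(m + Suc M). f n) / 2^(m + Suc M) - C\<bar> \<le> real K / 2^m" for M
  proof -
    define B where "B = (2::nat)^Suc M"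
    define D where "D s = (\<Sum>t<B. f (s + 2^m * t)) - B * c s" for s
    have D0: "D s = 0" if "s + K < 2^m" for s
    proof -
      \<comment> \<open>A function of a sign is its mean over both signs plus a multiple of the
        sign, and the latter sums to 0 over \<open>t < B\<close>.\<close>
      have "F (tm t) s = c s + tm t * (F 1 s - F (-1) s) / 2" for t
        using tm_cases[of t] by (auto simp: c_def field_simps)
      then have "(\<Sum>t<B. f (s + 2^m * t)) = (\<Sum>t<B. c s + tm t * ((F 1 s - F (-1) s) / 2))"
        using loc[OF that] by simp
      also have "\<dots> = B * c s + (\<Sum>t<B. tm t) * ((F 1 s - F (-1) s) / 2)"
        by (simp add: sum.distrib sum_distrib_right)
      finally show ?thesis by (simp add: D_def B_def sum_tm del: power_Suc)
    qed
    have D1: "\<bar>D s\<bar> \<le> B" for s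
    proof -
      have "0 \<le> (\<Sum>t<B. f (s + 2^m * t))" "(\<Sum>t<B. f (s + 2^m * t)) \<le> (\<Sum>t<B. 1)"
        using range by (auto intro!: sum_nonneg sum_mono simp del: sum_constant)
      moreover have "0 \<le> B * c s" "B * c s \<le> B"
        using c[of s] mult_left_mono[of "c s" 1 "real B"] by simp_all
      ultimately show ?thesis by (simp add: D_def)
    qed
    have "(\<Sum>n<2^(m + Suc M). f n) - 2^Suc M * (\<Sum>s<2^m. c s) = (\<Sum>s<2^m. D s)"
      unfolding power_add sum_mixed_radix D_def sum_subtractf B_def sum_distrib_left by simp
    also have "\<bar>\<dots>\<bar> \<le> (\<Sum>s<2^m. \<bar>D s\<bar>)" by (rule sum_abs)
    \<comment> \<open>Only the last \<open>K\<close> residues can overflow when \<open>K\<close> is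
      added, so all other errors are 0.\<close>
    also have "\<dots> = (\<Sum>s\<in>{2^m - K..<2^m}. \<bar>D s\<bar>)"
      by (rule sum.mono_neutral_right) (auto intro!: D0)
    also have "\<dots> \<le> (\<Sum>s\<in>{2^m - K..<2^m}. real B)" by (intro sum_mono D1)
    also have "\<dots> = card {2^m - K..<2^m} * real B" by simp
    also have "\<dots> \<le> K * real B" by (intro mult_right_mono of_nat_mono) auto
    finally have "\<bar>(\<Sum>n<2^(m + Suc M). f n) - 2^Suc M * (\<Sum>s<2^m. c s)\<bar> / 2^(m + Suc M)
        \<le> K * real B / 2^(m + Suc M)"
      by (rule divide_right_mono) simp
    moreover have "((\<Sum>n<2^(m + Suc M). f n) - 2^Suc M * (\<Sum>s<2^m. c s)) / 2^(m + Suc M)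
        = (\<Sum>n<2^(m + Suc M). f n) / 2^(m + Suc M) - C"
      by (simp add: C_def power_add diff_divide_distrib)
    moreover have "K * real B / 2^(m + Suc M) = K / 2^m" by (simp add: B_def power_add)
    ultimately show ?thesis by (metis abs_divide abs_numeral power_abs)
  qed
  have "\<forall>\<^sub>F N in sequentially. 1 / 2^N < e/2"
    using inverse_pow2_tendsto_0[of 1] \<open>e > 0\<close> by (intro order_tendstoD(2)[of _ 0]) auto
  then have "\<forall>\<^sub>F N in sequentially. \<bar>bavg f N - C\<bar> \<le> e"
    using eventually_gt_at_top[of m]
  proof eventually_elim
    case (elim N)
    have N: "m + Suc (N - Suc m) = N" using elim by simp
    have "\<bar>f (2^N) - f 0\<bar> \<le> 1" using range(1,2)[of "2^N"] range(1,2)[of 0] by auto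
    then have "\<bar>(f (2^N) - f 0) / 2^N\<bar> \<le> 1 / 2^N" by (simp add: abs_divide divide_right_mono)
    then show ?case using main[of "N - Suc m"] elim m unfolding N bavg_eq by linarith
  qed
  then show "\<exists>c. \<forall>\<^sub>F N in sequentially. \<bar>bavg f N - c\<bar> \<le> e" by blast
qed

section \<open>The set of odious numbers\<close>

definition odious :: "nat set" where
  "odious = {n. tm n = -1}"

lemma indicator_odious: "indicator odious n = (1 - tm n) / 2"
  using tm_cases[of n] by (auto simp: odious_def indicator_def)

lemma odious_subset: "odious \<subseteq> {1..}"
proof
  fix n assume "n \<in> odious"
  then have "n \<noteq> 0" by (cases "n = 0") (simp_all add: odious_def)
  then show "n \<in> {1..}" by simp
qed

lemma folner_dyadic: "folner_sequence (\<lambda>N. {1..2^N})"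
  unfolding folner_sequence_def
proof (intro conjI allI impI)
  fix t :: nat
  have bound: "real (card (sym_diff {1..2^N} ((\<lambda>n. n + t) ` {1..2^N}))) / real (card {1..(2::nat)^N})
      \<le> real (2 * t) / 2^N" for N
  proof -
    have "sym_diff {1..2^N} ((\<lambda>n. n + t) ` {1..2^N}) \<subseteq> {1..t} \<union> {2^N<..2^N + t}"
    proof
      fix x assume "x \<in> sym_diff {1..2^N} ((\<lambda>n. n + t) ` {1..2^N})"
      moreover have "x \<in> (\<lambda>n. n + t) ` {1..2^N}" if "t < x" "x \<le> 2^N"
        using that by (intro image_eqI[of _ _ "x - t"]) auto
      ultimately show "x \<in> {1..t} \<union> {2^N<..2^N + t}" by force
    qed
    then have "card (sym_diff {1..2^N} ((\<lambda>n. n + t) ` {1..2^N})) \<le> card ({1..t} \<union> {2^N<..2^N + t})"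
      by (intro card_mono) auto
    also have "\<dots> \<le> card {1..t} + card {2^N<..2^N + t}" by (rule card_Un_le)
    also have "\<dots> = 2 * t" by simp
    finally have "real (card (sym_diff {1..2^N} ((\<lambda>n. n + t) ` {1..2^N}))) \<le> real (2 * t)"
      by (rule of_nat_mono)
    then show ?thesis by (simp add: divide_right_mono)
  qed
  show "(\<lambda>N. real (card (sym_diff {1..2^N} ((\<lambda>n. n + t) ` {1..2^N}))) / real (card {1..(2::nat)^N})) \<longlonglongrightarrow> 0"
    by (rule tendsto_sandwich[OF _ _ tendsto_const inverse_pow2_tendsto_0[of "real (2 * t)"]])
       (use bound in auto)
qed auto

lemma relative_density_odious: "relative_density (\<lambda>N. {1..2^N}) odious \<longlonglongrightarrow> 1/2"
proof -
  have "relative_density (\<lambda>N. {1..2^N}) odious = (\<lambda>N. (1 - bavg tm N) / 2)"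
  proof
    fix N
    have "real (card (odious \<inter> {1..2^N})) = (\<Sum>n=1..2^N. indicator odious n)"
      by (simp add: indicator_def sum.If_cases Int_def conj_commute)
    also have "\<dots> = (2^N - (\<Sum>n=1..2^N. tm n)) / 2"
      by (simp add: indicator_odious sum_divide_distrib[symmetric] sum_subtractf)
    finally show "relative_density (\<lambda>N. {1..2^N}) odious N = (1 - bavg tm N) / 2"
      by (simp add: relative_density_def bavg_def diff_divide_distrib)
  qed
  moreover have "(\<lambda>N. (1 - bavg tm N) / 2) \<longlonglongrightarrow> (1 - 0) / 2"
    by (intro tendsto_intros bavg_tm_tendsto_0) simp
  ultimately show ?thesis by (simp only: diff_zero)
qed

lemma folner_density_odious: "folner_density (\<lambda>N. {1..2^N}) odious = 1/2"
  unfolding folner_density_def by (rule limI[OF relative_density_odious])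

text \<open>The indicator is real, so conjugation is trivial and each correlation averages a product
  of values of \<open>(1 - tm) / 2\<close> at bounded shifts; \<open>convergent_bavg_local\<close>
  applies.\<close>

lemma admits_correlations_odious: "admits_correlations (\<lambda>N. {1..2^N}) (indicator odious)"
  unfolding admits_correlations_def
proof (intro conjI allI impI)
  show "bounded (indicator odious ` {1..} :: complex set)"
    by (rule boundedI[of _ 1]) (auto simp: indicator_def)
  fix m :: nat and h \<epsilon> :: "nat \<Rightarrow> nat"
  define f where "f n = (\<Prod>i=1..m. (1 - tm (n + h i)) / 2)" for n
  \<comment> \<open>Normalising \<open>s\<close> to a sign keeps \<open>F\<close> in the unit
    interval for every real \<open>s\<close>.\<close>
  define F where "F s n = (\<Prod>i=1..m. (1 - (if s = 1 then 1 else -1) * tm (n + h i)) / 2)" for s :: real and n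
  have range: "0 \<le> (1 - tm n) / 2" "(1 - tm n) / 2 \<le> 1" "0 \<le> (1 + tm n) / 2" "(1 + tm n) / 2 \<le> 1" for n
    using tm_cases[of n] by auto
  have "convergent (bavg f)"
  proof (rule convergent_bavg_local[of f F "\<Sum>i=1..m. h i"])
    show "0 \<le> f n" "f n \<le> 1" for n
      unfolding f_def by (intro prod_nonneg prod_le_1 range conjI ballI)+
    show "0 \<le> F s n" "F s n \<le> 1" for s n
      unfolding F_def using range by (auto intro!: prod_nonneg prod_le_1)
    fix l s t :: nat assume st: "s + (\<Sum>i=1..m. h i) < 2^l"
    have "tm (s + 2^l * t + h i) = (if tm t = 1 then 1 else -1) * tm (s + h i)" if "i \<in> {1..m}" for i
    proof -
      have "h i \<le> (\<Sum>i=1..m. h i)" using that by (intro member_le_sum) auto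
      then have "s + h i < 2^l" using st by linarith
      then have "tm (s + h i + 2^l * t) = tm (s + h i) * tm t" by (rule tm_add)
      moreover have "s + 2^l * t + h i = s + h i + 2^l * t" by simp
      ultimately have "tm (s + 2^l * t + h i) = tm (s + h i) * tm t" by metis
      then show ?thesis using tm_cases[of t] by auto
    qed
    then show "f (s + 2^l * t) = F (tm t) s"
      unfolding f_def F_def by (intro prod.cong) simp_all
  qed
  then obtain L where L: "bavg f \<longlonglongrightarrow> L" by (auto simp: convergent_def)
  have "(cnj ^^ e) (complex_of_real x) = of_real x" for e x
    by (induction e) auto
  moreover have "(indicator odious n :: complex) = of_real ((1 - tm n) / 2)" for n
    using tm_cases[of n] by (auto simp: odious_def indicator_def)
  ultimately have "(\<Prod>i=1..m. (cnj ^^ \<epsilon> i) (indicator odious (n + h i))) = complex_of_real (f n)" for n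
    by (simp only: f_def of_real_prod)
  then have "folner_average (\<lambda>N. {1..2^N}) (\<lambda>n. \<Prod>i=1..m. (cnj ^^ \<epsilon> i) (indicator odious (n + h i)))
      = (\<lambda>N. complex_of_real (bavg f N))"
    by (simp add: folner_average_def bavg_def fun_eq_iff)
  then show "convergent (folner_average (\<lambda>N. {1..2^N})
      (\<lambda>n. \<Prod>i=1..m. (cnj ^^ \<epsilon> i) (indicator odious (n + h i))))"
    using tendsto_of_real[OF L] by (auto simp: convergent_def)
qed

lemma uniform_odious: "uniform_set_infinity (\<lambda>N. {1..2^N}) odious"
  unfolding uniform_set_infinity_def uniform_set_def
proof (intro allI impI conjI)
  fix k :: nat assume "k \<ge> 1"
  then obtain j where k: "k = Suc j" by (cases k) auto
  \<comment> \<open>As the density is 1/2, the centred indicator is \<open>tm\<close> scaled by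
    \<open>-1/2\<close>.\<close>
  have "has_unif k (\<lambda>n. (-1/2) * tm n) ((-1/2)^(2^k) * 0)"
    unfolding k by (intro has_unif_scale has_unif_tm)
  then have "uniformity_seminorm (\<lambda>N. {1..2^N}) k (\<lambda>n. complex_of_real ((-1/2) * tm n)) ^ (2^k) = 0"
    by (simp only: uniformity_seminorm_eq mult_zero_right of_real_0)
  moreover have "(indicator odious n :: complex) - of_real (1/2) = of_real ((-1/2) * tm n)" for n
    using tm_cases[of n] by (auto simp: odious_def indicator_def)
  ultimately show "uniformity_seminorm (\<lambda>N. {1..2^N}) k
     (\<lambda>n. indicator odious n - of_real (folner_density (\<lambda>N. {1..2^N}) odious)) = 0"
    by (simp only: folner_density_odious) simp
  show "convergent (relative_density (\<lambda>N. {1..2^N}) odious)"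
    using relative_density_odious by (auto simp: convergent_def)
next
  show "folner_density (\<lambda>N. {1..2^N}) odious > 0" unfolding folner_density_odious by simp
qed (rule odious_subset, rule admits_correlations_odious)

section \<open>Finite sums and the failure of the IP property\<close>

lemma sum_in_distinct_sums:
  assumes "finite S" "S \<subseteq> B"
  shows "\<Sum>S \<in> distinct_sums (card S) B"
proof -
  define xs where "xs = sorted_list_of_set S"
  have xs: "sorted_wrt (<) xs" "set xs = S" "length xs = card S"
    using assms by (simp_all add: xs_def)
  \<comment> \<open>Lists are indexed from 0, whereas \<open>distinct_sums\<close> counts from
    1.\<close>
  define b where "b i = xs ! (i - 1)" for i
  have "(\<Sum>i=1..card S. b i) = (\<Sum>i<card S. xs ! i)"
    unfolding b_def by (rule sum.reindex_bij_witness[of _ Suc "\<lambda>i. i - 1"]) auto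
  also have "\<dots> = sum_list xs" using xs(3) by (simp add: sum_list_sum_nth lessThan_atLeast0)
  also have "\<dots> = \<Sum>S" using assms(1) using xs(2) sum_list_distinct_conv_sum_set[of xs "\<lambda>x. x"]
    by (simp add: xs_def)
  finally have "\<Sum>S = (\<Sum>i=1..card S. b i)" by simp
  moreover have "b i \<in> B" if "i \<in> {1..card S}" for i
  proof -
    have "xs ! (i - 1) \<in> set xs" using that xs(3) by (intro nth_mem) auto
    then show ?thesis using xs(2) assms(2) by (auto simp: b_def)
  qed
  moreover have "strict_mono_on {1..card S} b"
  proof (rule strict_mono_onI)
    fix i j assume "i \<in> {1..card S}" "j \<in> {1..card S}" "i < j"
    then show "b i < b j"
      unfolding b_def using xs by (intro sorted_wrt_nth_less[of "(<)" xs]) auto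
  qed
  ultimately show ?thesis unfolding distinct_sums_def by blast
qed

text \<open>The values of \<open>tm\<close> at \<open>b\<close>, at a finite sum divisible by
  \<open>2^l\<close> with \<open>b < 2^l\<close>, and at their total would all be -1, although the
  third is the product of the other two.\<close>

lemma not_IP_odious: "\<not> IP_set odious"
proof
  assume "IP_set odious"
  then obtain B where B: "B \<subseteq> {1..}" "infinite B" and sums: "(\<Union>k\<in>{1..}. distinct_sums k B) \<subseteq> odious"
    by (auto simp: IP_set_def)
  have FS: "tm (\<Sum>S) = -1" if "finite S" "S \<noteq> {}" "S \<subseteq> B" for S
  proof -
    have "card S \<ge> 1" using that by (simp add: Suc_le_eq card_gt_0_iff)
    then have "\<Sum>S \<in> odious" using sum_in_distinct_sums[of S B] that sums by auto
    then show ?thesis by (simp add: odious_def)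
  qed
  obtain b where "b \<in> B" using B(2) by (metis equals0I finite.emptyI)
  define l where "l = b"
  have "b < 2^l" by (simp add: l_def)
  have "infinite (B - {b})" using B(2) by simp
  moreover have "finite ((\<lambda>n. n mod 2^l) ` (B - {b}))"
    by (rule finite_subset[of _ "{..<2^l}"]) auto
  ultimately obtain c where c: "infinite {n \<in> B - {b}. n mod 2^l = c mod 2^l}"
    using pigeonhole_infinite[of "B - {b}" "\<lambda>n. n mod 2^l"] by auto
  \<comment> \<open>Adding \<open>2^l\<close> numbers from one residue class modulo
    \<open>2^l\<close> yields a multiple of \<open>2^l\<close>.\<close>
  obtain S where S: "S \<subseteq> {n \<in> B - {b}. n mod 2^l = c mod 2^l}" "finite S" "card S = 2^l"
    using infinite_arbitrarily_large[OF c] by blast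
  have "\<Sum>S mod 2^l = (\<Sum>n\<in>S. n mod 2^l) mod 2^l" by (simp add: mod_sum_eq)
  also have "(\<Sum>n\<in>S. n mod 2^l) = (\<Sum>n\<in>S. c mod 2^l)"
    using S(1) by (intro sum.cong) auto
  finally have "2^l dvd \<Sum>S" using S(3) by (simp add: dvd_eq_mod_eq_0)
  then obtain q where q: "\<Sum>S = 2^l * q" by blast
  have "S \<noteq> {}" using S(3) by auto
  have "tm (\<Sum>(insert b S)) = tm (b + 2^l * q)"
    using S q by (subst sum.insert) auto
  also have "\<dots> = tm b * tm q" using \<open>b < 2^l\<close> by (rule tm_add)
  \<comment> \<open>Multiplying by \<open>2^l\<close> only appends zero digits.\<close>
  also have "tm q = tm (\<Sum>S)" using tm_add[of 0 l q] q by simp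
  finally have "tm (\<Sum>(insert b S)) = tm b * tm (\<Sum>S)" .
  moreover have "tm (\<Sum>(insert b S)) = -1" using S \<open>b \<in> B\<close> by (intro FS) auto
  moreover have "tm (\<Sum>S) = -1" using S \<open>S \<noteq> {}\<close> by (intro FS) auto
  moreover have "tm b = -1" using FS[of "{b}"] \<open>b \<in> B\<close> by simp
  ultimately show False by simp
qed

theorem corollary6p6:
  shows "\<exists>(\<Phi> :: nat \<Rightarrow> nat set) (A :: nat set).
    folner_sequence \<Phi> \<and> A \<subseteq> {1..} \<and> uniform_set_infinity \<Phi> A \<and> \<not> IP_set A"
  using folner_dyadic odious_subset uniform_odious not_IP_odious by blast

end
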